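(* Let $\mathcal X$ be a reflexive Banach space, let $\mathcal Y_0,\dots,\mathcal Y_{N-1}$ be uniformly smooth Banach spaces, and let $F_i:D(F_i)\subset\mathcal X\to\mathcal Y_i$ and $y_i\in\mathcal Y_i$ ($i=0,\dots,N-1$) satisfy Assumption A of the context (with constants $\rho>0$ and $0\le\eta<1$). Let $\Theta:\mathcal X\to(-\infty,\infty]$ be a proper, lower semi-continuous, $p$-convex function ($p\ge 2$) satisfying, for some constant $c_0>0$, $$D_\xi\Theta(\bar x,x)\ge c_0\|\bar x-x\|^p\quad\text{for all }\bar x\in\mathcal X,\ x\in D(\partial\Theta),\ \xi\in\partial\Theta(x).$$ Assume that $D_{\xi_0}\Theta(x^\dag,x_0)\le c_0\rho^p$. Let $1<r<\infty$, and let $\tau>1$ and $\mu_0>0$ satisfy $$1-\eta-\frac{1+\eta}{\tau}-\frac{p-1}{p}\left(\frac{\mu_0}{2c_0}\right)^{\frac1{p-1}}>0.$$ For each $\delta>0$ let $y_i^\delta\in\mathcal Y_i$ satisfy $\|y_i^\delta-y_i\|\le\delta$ for $i=0,\dots,N-1$, and let $\{\xi_n^\delta\}$, $\{x_n^\delta\}$ and $n_\delta$ be defined by the Landweber–Kaczmarz algorithm of the context with these data and the parameters $r,\tau,\mu_0$. Then there is a solution $x_*\in B_{2\rho}(x_0)\cap D(\Theta)$ of the system $F_i(x)=y_i$, $i=0,\dots,N-1$, such that $$\lim_{\delta\to0}\|x_{n_\delta}^\delta-x_*\|=0\qquad\text{and}\qquad\lim_{\delta\to0}D_{\xi_{n_\delta}^\delta}\Theta(x_*,x_{n_\delta}^\delta)=0.$$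 If in addition $\mathcal N(F_i'(x^\dag))\subset\mathcal N(F_i'(x))$ for all $x\in B_{2\rho}(x_0)\cap\mathcal D$ and $i=0,\dots,N-1$, then $x_*=x^\dag$.
   Context: Notation. $\mathcal X^*$ is the dual of $\mathcal X$, $\langle\cdot,\cdot\rangle$ the duality pairing, $\mathcal N(A)$ the null space of a bounded linear operator $A$, $A^*$ its adjoint, $B_\rho(x_0)=\{x\in\mathcal X:\|x-x_0\|\le\rho\}$, and $\mathcal D=\bigcap_{i=0}^{N-1}D(F_i)$, assumed non-empty. For a convex $\Theta:\mathcal X\to(-\infty,\infty]$: $D(\Theta)=\{x:\Theta(x)<\infty\}$, $\partial\Theta(x)=\{\xi\in\mathcal X^*:\Theta(z)-\Theta(x)-\langle\xi,z-x\rangle\ge0\ \forall z\in\mathcal X\}$, $D(\partial\Theta)=\{x\in D(\Theta):\partial\Theta(x)\ne\emptyset\}$, and for $x\in D(\partial\Theta)$, $\xi\in\partial\Theta(x)$ the Bregman distance is $D_\xi\Theta(z,x)=\Theta(z)-\Theta(x)-\langle\xi,z-x\rangle$. $\Theta$ is $p$-convex ($p\ge2$) if for some $c>0$, $\Theta(\lambda\bar x+(1-\lambda)x)+\lambda(1-\lambda)c\|\bar x-x\|^p\le\lambda\Theta(\bar x)+(1-\lambda)\Theta(x)$ for all $\bar x,x\in\mathcal X$, $\lambda\in(0,1)$. For a Banach space $\mathcal Y$ and $1<r<\infty$, $J_r^{\mathcal Y}(y)=\{\zeta\in\mathcal Y^*:\|\zeta\|=\|y\|^{r-1},\ \langle\zeta,y\rangle=\|y\|^r\}$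 is the duality mapping with gauge $t\mapsto t^{r-1}$; it is single valued when $\mathcal Y$ is uniformly smooth. Initial guess and $x^\dag$. Fix $\xi_0\in\mathcal X^*$ and $x_0=\arg\min_{x\in\mathcal X}\{\Theta(x)-\langle\xi_0,x\rangle\}$, so that $x_0\in D(\partial\Theta)$ and $\xi_0\in\partial\Theta(x_0)$. $x^\dag\in D(\Theta)\cap\mathcal D$ denotes a solution of the system $F_i(x)=y_i$, $i=0,\dots,N-1$, with $$D_{\xi_0}\Theta(x^\dag,x_0)=\min_{x\in D(\Theta)\cap\mathcal D}\{D_{\xi_0}\Theta(x,x_0):F_i(x)=y_i,\ i=0,\dots,N-1\}.$$ Assumption A. (a) There is $\rho>0$ such that $B_{2\rho}(x_0)\subset\mathcal D$ and the system $F_i(x)=y_i$, $i=0,\dots,N-1$, has a solution in $B_\rho(x_0)\cap D(\Theta)$. (b) Each $F_i$ is weakly closed on $\mathcal D$ (i.e. if $\{x_n\}\subset\mathcal D$ converges weakly to $x\in\mathcal X$ and $\{F_i(x_n)\}$ converges weakly to $v\in\mathcal Y_i$, then $x\in\mathcal D$ and $F_i(x)=v$), is Fréchet differentiable on $B_{2\rho}(x_0)$ with derivative $F_i'(x)$, and $x\mapsto F_i'(x)$ is continuous on $B_{2\rho}(x_0)$. (c) $\|F_i'(x)\|\le1$ for $x\in B_{2\rho}(x_0)$ and all $i$. (d) There is $0\le\eta<1$ such that $\|F_i(x)-F_i(\bar x)-F_i'(\bar x)(x-\bar x)\|\le\eta\|F_i(x)-F_i(\bar x)\|$ for all $x,\bar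 x\in B_{2\rho}(x_0)$ and $i=0,\dots,N-1$. Landweber–Kaczmarz algorithm. Set $\xi_0^\delta=\xi_0$, $x_0^\delta=x_0$. Given $\xi_n^\delta,x_n^\delta$, set $\xi_{n,0}^\delta=\xi_n^\delta$, $x_{n,0}^\delta=x_n^\delta$ and for $i=0,\dots,N-1$ $$\xi_{n,i+1}^\delta=\xi_{n,i}^\delta-\mu_{n,i}^\delta F_i'(x_{n,i}^\delta)^*J_r^{\mathcal Y_i}(F_i(x_{n,i}^\delta)-y_i^\delta),\qquad x_{n,i+1}^\delta=\arg\min_{x\in\mathcal X}\{\Theta(x)-\langle\xi_{n,i+1}^\delta,x\rangle\},$$ where $\mu_{n,i}^\delta=\mu_0\|F_i(x_{n,i}^\delta)-y_i^\delta\|^{p-r}$ if $\|F_i(x_{n,i}^\delta)-y_i^\delta\|>\tau\delta$ and $\mu_{n,i}^\delta=0$ otherwise. Then $\xi_{n+1}^\delta=\xi_{n,N}^\delta$, $x_{n+1}^\delta=x_{n,N}^\delta$. Let $n_\delta$ be the first integer $n\ge 0$ such that $\mu_{n,i}^\delta=0$ for all $i=0,\dots,N-1$. *)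

theory Defs
  imports "HOL-Analysis.Analysis"
begin

text \<open>
  The space \<open>X\<close> is a type \<open>'a::banach\<close> with dual \<open>'a \<Rightarrow>\<^sub>L real\<close>.  The spaces
  \<open>Y\<^sub>0, \<dots>, Y\<^sub>N\<^sub>-\<^sub>1\<close> may be pairwise different, so they cannot all be one type; they are given as
  closed linear subspaces \<open>Y i\<close> of one Banach space \<open>'b\<close>.  This is no restriction: finitely many
  Banach spaces embed isometrically as closed subspaces of, for instance, their
  \<open>\<ell>\<^sup>2\<close>-direct sum.  \<open>'b\<close> itself need not be uniformly smooth.  Notions concerning
  a \<open>Y i\<close> (dual space, weak convergence, uniform smoothness, duality mapping) are taken intrinsically in \<open>Y i\<close>.
\<close>

definition reflexive_space :: "'a::real_normed_vector itself \<Rightarrow> bool" where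
  "reflexive_space _ \<longleftrightarrow>
     (\<forall>\<Phi> :: ('a \<Rightarrow>\<^sub>L real) \<Rightarrow>\<^sub>L real. \<exists>x :: 'a. \<forall>\<xi>. blinfun_apply \<Phi> \<xi> = blinfun_apply \<xi> x)"

definition weakly_tendsto :: "(nat \<Rightarrow> 'a::real_normed_vector) \<Rightarrow> 'a \<Rightarrow> bool" where
  "weakly_tendsto u x \<longleftrightarrow>
     (\<forall>\<xi> :: 'a \<Rightarrow>\<^sub>L real. (\<lambda>n. blinfun_apply \<xi> (u n)) \<longlonglongrightarrow> blinfun_apply \<xi> x)"

definition null_space :: "('a::real_normed_vector \<Rightarrow>\<^sub>L 'b::real_normed_vector) \<Rightarrow> 'a set" where
  "null_space A = {h. blinfun_apply A h = 0}"


section \<open>Closed subspaces as Banach spaces\<close>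

text \<open>
  Functionals on \<open>Y\<close> are extended by \<open>0\<close> outside \<open>Y\<close> (not linearly), so that each functional has
  exactly one representative.
\<close>

definition dual_on :: "'b::real_normed_vector set \<Rightarrow> ('b \<Rightarrow> real) set" where
  "dual_on Y = {\<zeta>. (\<forall>u\<in>Y. \<forall>v\<in>Y. \<zeta> (u + v) = \<zeta> u + \<zeta> v)
                 \<and> (\<forall>a. \<forall>u\<in>Y. \<zeta> (a *\<^sub>R u) = a * \<zeta> u)
                 \<and> (\<exists>K. \<forall>u\<in>Y. \<bar>\<zeta> u\<bar> \<le> K * norm u)
                 \<and> (\<forall>u. u \<notin> Y \<longrightarrow> \<zeta> u = 0)}"

definition dual_norm_on :: "'b::real_normed_vector set \<Rightarrow> ('b \<Rightarrow> real) \<Rightarrow> real" where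
  "dual_norm_on Y \<zeta> = (SUP u \<in> {u \<in> Y. norm u \<le> 1}. \<bar>\<zeta> u\<bar>)"

definition weakly_tendsto_on ::
    "'b::real_normed_vector set \<Rightarrow> (nat \<Rightarrow> 'b) \<Rightarrow> 'b \<Rightarrow> bool" where
  "weakly_tendsto_on Y u v \<longleftrightarrow> (\<forall>\<zeta> \<in> dual_on Y. (\<lambda>n. \<zeta> (u n)) \<longlonglongrightarrow> \<zeta> v)"

text \<open>
  The element \<open>0\<close> only matters for \<open>Y = {0}\<close>: the supremum is nonnegative as soon as \<open>Y\<close> contains a
  unit vector.
\<close>

definition smoothness_modulus :: "'b::real_normed_vector set \<Rightarrow> real \<Rightarrow> real" where
  "smoothness_modulus Y s =
     Sup (insert 0 {norm (u + v) + norm (u - v) - 2 | u v.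
                      u \<in> Y \<and> v \<in> Y \<and> norm u = 1 \<and> norm v \<le> s})"

definition uniformly_smooth_on :: "'b::real_normed_vector set \<Rightarrow> bool" where
  "uniformly_smooth_on Y \<longleftrightarrow> ((\<lambda>s. smoothness_modulus Y s / s) \<longlongrightarrow> 0) (at_right 0)"

definition duality_map :: "'b::real_normed_vector set \<Rightarrow> real \<Rightarrow> 'b \<Rightarrow> ('b \<Rightarrow> real) set" where
  "duality_map Y r y =
     {\<zeta> \<in> dual_on Y. dual_norm_on Y \<zeta> = norm y powr (r - 1) \<and> \<zeta> y = norm y powr r}"

text \<open>
  The adjoint \<open>Y\<^sup>* \<rightarrow> X\<^sup>*\<close> of a bounded linear operator \<open>A\<close> with values in \<open>Y\<close>.
\<close>

definition adjoint_on ::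
    "('a::real_normed_vector \<Rightarrow>\<^sub>L 'b::real_normed_vector) \<Rightarrow> ('b \<Rightarrow> real) \<Rightarrow> ('a \<Rightarrow>\<^sub>L real)" where
  "adjoint_on A \<zeta> = Blinfun (\<lambda>h. \<zeta> (blinfun_apply A h))"


section \<open>Convex analysis\<close>

definition dom_fun :: "('a \<Rightarrow> ereal) \<Rightarrow> 'a set" where
  "dom_fun \<Theta> = {x. \<Theta> x < \<infinity>}"

definition proper_fun :: "('a \<Rightarrow> ereal) \<Rightarrow> bool" where
  "proper_fun \<Theta> \<longleftrightarrow> (\<forall>x. \<Theta> x \<noteq> -\<infinity>) \<and> dom_fun \<Theta> \<noteq> {}"

definition lower_semicontinuous :: "('a::topological_space \<Rightarrow> ereal) \<Rightarrow> bool" where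
  "lower_semicontinuous \<Theta> \<longleftrightarrow> (\<forall>x. \<Theta> x \<le> Liminf (at x) \<Theta>)"

definition p_convex :: "real \<Rightarrow> ('a::real_normed_vector \<Rightarrow> ereal) \<Rightarrow> bool" where
  "p_convex p \<Theta> \<longleftrightarrow> (\<exists>c>0. \<forall>x' x. \<forall>l\<in>{0<..<1}.
     \<Theta> (l *\<^sub>R x' + (1 - l) *\<^sub>R x) + ereal (l * (1 - l) * c * norm (x' - x) powr p)
       \<le> ereal l * \<Theta> x' + ereal (1 - l) * \<Theta> x)"

text \<open>
  The following two definitions are only used at points \<open>x\<close> with \<open>\<Theta> x\<close> finite.
\<close>

definition bregman ::
    "('a::real_normed_vector \<Rightarrow> ereal) \<Rightarrow> ('a \<Rightarrow>\<^sub>L real) \<Rightarrow> 'a \<Rightarrow> 'a \<Rightarrow> ereal" where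
  "bregman \<Theta> \<xi> z x = \<Theta> z - \<Theta> x - ereal (blinfun_apply \<xi> (z - x))"

definition subdifferential ::
    "('a::real_normed_vector \<Rightarrow> ereal) \<Rightarrow> 'a \<Rightarrow> ('a \<Rightarrow>\<^sub>L real) set" where
  "subdifferential \<Theta> x = {\<xi>. \<forall>z. \<Theta> z - \<Theta> x - ereal (blinfun_apply \<xi> (z - x)) \<ge> 0}"

definition dom_subdifferential :: "('a::real_normed_vector \<Rightarrow> ereal) \<Rightarrow> 'a set" where
  "dom_subdifferential \<Theta> = {x \<in> dom_fun \<Theta>. subdifferential \<Theta> x \<noteq> {}}"

definition argmin_tilted ::
    "('a::real_normed_vector \<Rightarrow> ereal) \<Rightarrow> ('a \<Rightarrow>\<^sub>L real) \<Rightarrow> 'a" where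
  "argmin_tilted \<Theta> \<xi> = arg_min (\<lambda>x. \<Theta> x - ereal (blinfun_apply \<xi> x)) (\<lambda>_. True)"


section \<open>The system and the assumptions on it\<close>

definition solves :: "nat \<Rightarrow> (nat \<Rightarrow> 'a \<Rightarrow> 'b) \<Rightarrow> (nat \<Rightarrow> 'b) \<Rightarrow> 'a \<Rightarrow> bool" where
  "solves N F y x \<longleftrightarrow> (\<forall>i<N. F i x = y i)"

definition weakly_closed_on ::
    "'b::real_normed_vector set \<Rightarrow> 'a::real_normed_vector set \<Rightarrow> ('a \<Rightarrow> 'b) \<Rightarrow> bool" where
  "weakly_closed_on Y D G \<longleftrightarrow>
     (\<forall>u x v. (\<forall>n. u n \<in> D) \<longrightarrow> weakly_tendsto u x \<longrightarrow> v \<in> Y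
        \<longrightarrow> weakly_tendsto_on Y (\<lambda>n. G (u n)) v \<longrightarrow> x \<in> D \<and> G x = v)"

text \<open>
  In \<open>assumption_A\<close>, \<open>DF i\<close> is the domain \<open>D(F\<^sub>i)\<close> and \<open>F' i x\<close> is the derivative of \<open>F i\<close> at \<open>x\<close>.
  As \<open>B\<^sub>2\<^sub>\<rho>(x\<^sub>0)\<close> is a closed ball that may equal \<open>D(F\<^sub>i)\<close>, differentiability is understood within
  the ball, which at interior points is the ordinary notion.  Nothing is required of \<open>F' i x\<close>
  outside the ball.
\<close>

definition assumption_A ::
    "nat \<Rightarrow> (nat \<Rightarrow> 'b::real_normed_vector set) \<Rightarrow> (nat \<Rightarrow> 'a::real_normed_vector set)
     \<Rightarrow> (nat \<Rightarrow> 'a \<Rightarrow> 'b) \<Rightarrow> (nat \<Rightarrow> 'a \<Rightarrow> ('a \<Rightarrow>\<^sub>L 'b)) \<Rightarrow> (nat \<Rightarrow> 'b) \<Rightarrow> ('a \<Rightarrow> ereal)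
     \<Rightarrow> 'a \<Rightarrow> real \<Rightarrow> real \<Rightarrow> bool" where
  "assumption_A N Y DF F F' y \<Theta> x0 \<rho> \<eta> \<longleftrightarrow>
     \<rho> > 0
   \<and> cball x0 (2 * \<rho>) \<subseteq> (\<Inter>i<N. DF i)
   \<and> (\<exists>x \<in> cball x0 \<rho> \<inter> dom_fun \<Theta>. solves N F y x)
   \<and> (\<forall>i<N. weakly_closed_on (Y i) (\<Inter>j<N. DF j) (F i))
   \<and> (\<forall>i<N. \<forall>x \<in> cball x0 (2 * \<rho>).
         (F i has_derivative blinfun_apply (F' i x)) (at x within cball x0 (2 * \<rho>)))
   \<and> (\<forall>i<N. continuous_on (cball x0 (2 * \<rho>)) (F' i))
   \<and> (\<forall>i<N. \<forall>x \<in> cball x0 (2 * \<rho>). norm (F' i x) \<le> 1)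
   \<and> 0 \<le> \<eta> \<and> \<eta> < 1
   \<and> (\<forall>i<N. \<forall>x \<in> cball x0 (2 * \<rho>). \<forall>x' \<in> cball x0 (2 * \<rho>).
         norm (F i x - F i x' - blinfun_apply (F' i x') (x - x')) \<le> \<eta> * norm (F i x - F i x'))"


section \<open>The Landweber--Kaczmarz iteration\<close>

definition lk_stepsize :: "real \<Rightarrow> real \<Rightarrow> real \<Rightarrow> real \<Rightarrow> real \<Rightarrow> 'b::real_normed_vector \<Rightarrow> real" where
  "lk_stepsize p r \<tau> \<mu>0 \<delta> v = (if norm v > \<tau> * \<delta> then \<mu>0 * norm v powr (p - r) else 0)"

text \<open>
  One substep, from \<open>(\<xi>\<^sub>n\<^sub>,\<^sub>i, x\<^sub>n\<^sub>,\<^sub>i)\<close> to \<open>(\<xi>\<^sub>n\<^sub>,\<^sub>i\<^sub>+\<^sub>1, x\<^sub>n\<^sub>,\<^sub>i\<^sub>+\<^sub>1)\<close>.  The duality mapping is single valued as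
  \<open>Y i\<close> is uniformly smooth, hence \<open>the_elem\<close>.  The argument \<open>yd\<close> is the noisy data for the
  noise level \<open>\<delta>\<close>.
\<close>

definition lk_step ::
    "(nat \<Rightarrow> 'b::real_normed_vector set) \<Rightarrow> (nat \<Rightarrow> 'a::real_normed_vector \<Rightarrow> 'b)
     \<Rightarrow> (nat \<Rightarrow> 'a \<Rightarrow> ('a \<Rightarrow>\<^sub>L 'b)) \<Rightarrow> ('a \<Rightarrow> ereal) \<Rightarrow> real \<Rightarrow> real \<Rightarrow> real \<Rightarrow> real \<Rightarrow> real
     \<Rightarrow> (nat \<Rightarrow> 'b) \<Rightarrow> nat \<Rightarrow> ('a \<Rightarrow>\<^sub>L real) \<times> 'a \<Rightarrow> ('a \<Rightarrow>\<^sub>L real) \<times> 'a" where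
  "lk_step Y F F' \<Theta> p r \<tau> \<mu>0 \<delta> yd i s =
     (let \<xi> = fst s; x = snd s; v = F i x - yd i;
          \<xi>' = \<xi> - lk_stepsize p r \<tau> \<mu>0 \<delta> v
                    *\<^sub>R adjoint_on (F' i x) (the_elem (duality_map (Y i) r v))
      in (\<xi>', argmin_tilted \<Theta> \<xi>'))"

primrec lk_inner ::
    "(nat \<Rightarrow> 'b::real_normed_vector set) \<Rightarrow> (nat \<Rightarrow> 'a::real_normed_vector \<Rightarrow> 'b)
     \<Rightarrow> (nat \<Rightarrow> 'a \<Rightarrow> ('a \<Rightarrow>\<^sub>L 'b)) \<Rightarrow> ('a \<Rightarrow> ereal) \<Rightarrow> real \<Rightarrow> real \<Rightarrow> real \<Rightarrow> real \<Rightarrow> real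
     \<Rightarrow> (nat \<Rightarrow> 'b) \<Rightarrow> ('a \<Rightarrow>\<^sub>L real) \<times> 'a \<Rightarrow> nat \<Rightarrow> ('a \<Rightarrow>\<^sub>L real) \<times> 'a" where
  "lk_inner Y F F' \<Theta> p r \<tau> \<mu>0 \<delta> yd s 0 = s"
| "lk_inner Y F F' \<Theta> p r \<tau> \<mu>0 \<delta> yd s (Suc i) =
     lk_step Y F F' \<Theta> p r \<tau> \<mu>0 \<delta> yd i (lk_inner Y F F' \<Theta> p r \<tau> \<mu>0 \<delta> yd s i)"

primrec lk_iter ::
    "nat \<Rightarrow> (nat \<Rightarrow> 'b::real_normed_vector set) \<Rightarrow> (nat \<Rightarrow> 'a::real_normed_vector \<Rightarrow> 'b)
     \<Rightarrow> (nat \<Rightarrow> 'a \<Rightarrow> ('a \<Rightarrow>\<^sub>L 'b)) \<Rightarrow> ('a \<Rightarrow> ereal) \<Rightarrow> real \<Rightarrow> real \<Rightarrow> real \<Rightarrow> real \<Rightarrow> real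
     \<Rightarrow> (nat \<Rightarrow> 'b) \<Rightarrow> ('a \<Rightarrow>\<^sub>L real) \<times> 'a \<Rightarrow> nat \<Rightarrow> ('a \<Rightarrow>\<^sub>L real) \<times> 'a" where
  "lk_iter N Y F F' \<Theta> p r \<tau> \<mu>0 \<delta> yd s0 0 = s0"
| "lk_iter N Y F F' \<Theta> p r \<tau> \<mu>0 \<delta> yd s0 (Suc n) =
     lk_inner Y F F' \<Theta> p r \<tau> \<mu>0 \<delta> yd (lk_iter N Y F F' \<Theta> p r \<tau> \<mu>0 \<delta> yd s0 n) N"

definition lk_stop ::
    "nat \<Rightarrow> (nat \<Rightarrow> 'b::real_normed_vector set) \<Rightarrow> (nat \<Rightarrow> 'a::real_normed_vector \<Rightarrow> 'b)
     \<Rightarrow> (nat \<Rightarrow> 'a \<Rightarrow> ('a \<Rightarrow>\<^sub>L 'b)) \<Rightarrow> ('a \<Rightarrow> ereal) \<Rightarrow> real \<Rightarrow> real \<Rightarrow> real \<Rightarrow> real \<Rightarrow> real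
     \<Rightarrow> (nat \<Rightarrow> 'b) \<Rightarrow> ('a \<Rightarrow>\<^sub>L real) \<times> 'a \<Rightarrow> nat" where
  "lk_stop N Y F F' \<Theta> p r \<tau> \<mu>0 \<delta> yd s0 =
     (LEAST n. \<forall>i<N.
        lk_stepsize p r \<tau> \<mu>0 \<delta>
          (F i (snd (lk_inner Y F F' \<Theta> p r \<tau> \<mu>0 \<delta> yd
                       (lk_iter N Y F F' \<Theta> p r \<tau> \<mu>0 \<delta> yd s0 n) i)) - yd i) = 0)"

end

theory Submission
  imports Defs
begin

text \<open>
  Write \<open>D \<xi> z\<close> for the Bregman distance of \<open>z\<close> from the minimiser \<open>X \<xi>\<close> of \<open>\<Theta> - \<xi>\<close>.  Along the
  iteration, \<open>D \<xi> z\<close> decreases for every solution \<open>z\<close> by at least a multiple of the \<open>p\<close>-th power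
  of the active residual; this keeps the iterates in the ball and forces the discrepancy principle
  to stop.  For exact data (the iteration with \<open>\<delta> = 0\<close>), let \<open>V n\<close> be the sum of the residuals
  of the \<open>n\<close>-th sweep.  If \<open>V l\<close> is minimal among \<open>V 0, \<dots>, V l\<close>, the tangential cone condition bounds
  \<open>(\<xi>\<^sub>l - \<xi>\<^sub>k) (x\<^sub>l - z)\<close> by a multiple of the sum of \<open>(V n)\<^sup>p\<close> over \<open>k \<le> n < l\<close>, hence by
  \<open>D \<xi>\<^sub>k z - D \<xi>\<^sub>l z\<close>, so the iterates at such record minima form a Cauchy sequence, whose limit
  \<open>x\<^sub>*\<close> satisfies \<open>D \<xi>\<^sub>n x\<^sub>* \<rightarrow> 0\<close>.  Each noisy iterate converges to the exact one as \<open>\<delta> \<rightarrow> 0\<close>, because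
  uniform smoothness makes the duality mapping norm continuous; monotonicity of \<open>D\<close> then carries
  the smallness of \<open>D \<xi>\<^sub>n x\<^sub>*\<close> over to the stopping index.  Under the null space condition
  \<open>\<xi>\<^sub>n - \<xi>\<^sub>0\<close> annihilates \<open>x\<^sub>* - x\<^sup>\<dagger>\<close>, so \<open>D \<xi>\<^sub>n x\<^sup>\<dagger> \<le> D \<xi>\<^sub>n x\<^sub>*\<close>, and the iterates converge to both points.
\<close>

section \<open>Duality mappings of uniformly smooth subspaces\<close>

text \<open>One radius suffices: functionals are compared on vectors of norm at most
  \<open>s\<close> and then rescaled, so only the size of the error \<open>\<epsilon> * s\<close>
  relative to \<open>s\<close> matters.\<close>

lemma uniformly_smooth_onE:
  assumes "uniformly_smooth_on Y" "\<epsilon> > 0"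
  obtains s where "s > 0" and
    "\<And>u w. u \<in> Y \<Longrightarrow> w \<in> Y \<Longrightarrow> norm u = 1 \<Longrightarrow> norm w \<le> s \<Longrightarrow> norm (u + w) + norm (u - w) \<le> 2 + \<epsilon> * s"
proof -
  have "eventually (\<lambda>s. smoothness_modulus Y s / s < \<epsilon>) (at_right 0)"
    using assms by (auto simp: uniformly_smooth_on_def order_tendsto_iff)
  then have "eventually (\<lambda>s. smoothness_modulus Y s / s < \<epsilon> \<and> s > 0) (at_right 0)"
    using eventually_at_right_less by (rule eventually_conj)
  then obtain s where s: "smoothness_modulus Y s / s < \<epsilon>" "s > 0"
    using eventually_happens'[OF trivial_limit_at_right_real] by blast
  then have le: "smoothness_modulus Y s \<le> \<epsilon> * s"
    by (simp add: field_simps)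
  show thesis
  proof
    fix u w assume uw: "u \<in> Y" "w \<in> Y" "norm u = 1" "norm w \<le> s"
    let ?S = "{norm (u + v) + norm (u - v) - 2 | u v. u \<in> Y \<and> v \<in> Y \<and> norm u = 1 \<and> norm v \<le> s}"
    have "bdd_above (insert 0 ?S)"
    proof (rule bdd_aboveI)
      fix a assume "a \<in> insert 0 ?S"
      moreover have "norm (u + v) + norm (u - v) - 2 \<le> 2 * s" if "norm u = 1" "norm v \<le> s" for u v :: 'a
        using norm_triangle_ineq[of u v] norm_triangle_ineq4[of u v] that by linarith
      ultimately show "a \<le> 2 * s"
        using s(2) by auto
    qed
    then have "norm (u + w) + norm (u - w) - 2 \<le> smoothness_modulus Y s"
      unfolding smoothness_modulus_def using uw by (intro cSup_upper) auto
    then show "norm (u + w) + norm (u - w) \<le> 2 + \<epsilon> * s"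
      using le by linarith
  qed (use s in auto)
qed

lemma dual_on_add: "\<zeta> \<in> dual_on Y \<Longrightarrow> u \<in> Y \<Longrightarrow> v \<in> Y \<Longrightarrow> \<zeta> (u + v) = \<zeta> u + \<zeta> v"
  and dual_on_scaleR: "\<zeta> \<in> dual_on Y \<Longrightarrow> u \<in> Y \<Longrightarrow> \<zeta> (a *\<^sub>R u) = a * \<zeta> u"
  and dual_on_outside: "\<zeta> \<in> dual_on Y \<Longrightarrow> u \<notin> Y \<Longrightarrow> \<zeta> u = 0"
  by (auto simp: dual_on_def)

lemma dual_on_diff:
  assumes "\<zeta> \<in> dual_on Y" "subspace Y" "u \<in> Y" "v \<in> Y"
  shows "\<zeta> (u - v) = \<zeta> u - \<zeta> v"
  using dual_on_add[OF assms(1,3), of "(-1) *\<^sub>R v"] dual_on_scaleR[OF assms(1,4), of "-1"]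
    subspace_scale[OF assms(2,4), of "-1"] by simp

lemma dual_on_cmult: "\<zeta> \<in> dual_on Y \<Longrightarrow> (\<lambda>u. c * \<zeta> u) \<in> dual_on Y"
proof -
  assume z: "\<zeta> \<in> dual_on Y"
  then obtain K where "\<forall>u\<in>Y. \<bar>\<zeta> u\<bar> \<le> K * norm u"
    by (auto simp: dual_on_def)
  then have "\<forall>u\<in>Y. \<bar>c * \<zeta> u\<bar> \<le> (\<bar>c\<bar> * K) * norm u"
    by (auto simp: abs_mult mult.assoc intro!: mult_left_mono)
  then have "\<exists>K. \<forall>u\<in>Y. \<bar>c * \<zeta> u\<bar> \<le> K * norm u" ..
  then show ?thesis
    using z unfolding dual_on_def by (simp add: algebra_simps)
qed

text \<open>A supporting functional of the unit vector \<open>e\<close>. The pointwise inequality on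
  \<open>Y\<close> says that its dual norm is at most 1 without mentioning a supremum.\<close>

definition norming :: "'b::real_normed_vector set \<Rightarrow> 'b \<Rightarrow> ('b \<Rightarrow> real) \<Rightarrow> bool" where
  "norming Y e \<zeta> \<longleftrightarrow> e \<in> Y \<and> norm e = 1 \<and> \<zeta> \<in> dual_on Y \<and> (\<forall>w\<in>Y. \<bar>\<zeta> w\<bar> \<le> norm w) \<and> \<zeta> e = 1"

text \<open>The norming functional is the derivative of the norm at \<open>y\<close>, which uniform smoothness
  makes linear; this replaces the Hahn--Banach theorem.\<close>

lemma norming_functional_exists:
  fixes Y :: "'b::real_normed_vector set"
  assumes sub: "subspace Y" and sm: "uniformly_smooth_on Y" and y: "y \<in> Y" "norm y = 1"
  obtains \<zeta> where "norming Y y \<zeta>"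
proof -
  \<comment> \<open>\<open>g v\<close> is the difference quotient of the norm at \<open>y\<close> in
    direction \<open>v\<close>. It is monotone by convexity, so its infimum \<open>q v\<close> over
    positive \<open>t\<close> is the one-sided derivative.\<close>
  define g where "g v t = (norm (y + t *\<^sub>R v) - 1) / t" for v t
  define q where "q v = Inf (g v ` {0<..})" for v
  have g_low: "- norm v \<le> g v t" if "t > 0" for v t
    using norm_triangle_ineq4[of "y + t *\<^sub>R v" "t *\<^sub>R v"] that y
    by (simp add: g_def field_simps)
  have g_up: "g v t \<le> norm v" if "t > 0" for v t
    using norm_triangle_ineq[of "y" "t *\<^sub>R v"] that y
    by (simp add: g_def field_simps)
  have bdd: "bdd_below (g v ` {0<..})" for v
    by (rule bdd_belowI2) (use g_low in auto)
  have q_le: "q v \<le> g v t" if "t > 0" for v t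
    unfolding q_def using that bdd by (intro cInf_lower) auto
  have q_ge: "c \<le> q v" if "\<And>t. t > 0 \<Longrightarrow> c \<le> g v t" for c v
    unfolding q_def using that by (intro cInf_greatest) auto
  have mono: "g v s \<le> g v t" if "0 < s" "s \<le> t" for v s t
  proof -
    have "y + s *\<^sub>R v = (1 - s / t) *\<^sub>R y + (s / t) *\<^sub>R (y + t *\<^sub>R v)"
      using that by (simp add: algebra_simps)
    also have "norm \<dots> \<le> (1 - s / t) * 1 + (s / t) * norm (y + t *\<^sub>R v)"
      using norm_triangle_ineq[of "(1 - s / t) *\<^sub>R y" "(s / t) *\<^sub>R (y + t *\<^sub>R v)"] that y
      by (simp add: abs_of_nonneg)
    finally have "norm (y + s *\<^sub>R v) - 1 \<le> s * ((norm (y + t *\<^sub>R v) - 1) / t)"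
      by (simp add: field_simps diff_divide_distrib)
    then show ?thesis
      using that by (simp add: g_def pos_divide_le_eq mult.commute)
  qed
  have q_lt: "\<exists>T>0. \<forall>t. 0 < t \<longrightarrow> t \<le> T \<longrightarrow> g v t < q v + \<epsilon>" if "\<epsilon> > 0" for v \<epsilon>
  proof -
    have ne: "g v ` {0<..} \<noteq> {}" using greaterThan_non_empty by blast
    have "Inf (g v ` {0<..}) < q v + \<epsilon>"
      using that by (simp add: q_def)
    from cInf_lessD[OF ne this] obtain T where "T > 0" "g v T < q v + \<epsilon>"
      by auto
    then show ?thesis
      using mono by (meson le_less_trans)
  qed
  \<comment> \<open>Subadditivity passes through the midpoint of \<open>y + 2 t v\<close> and
    \<open>y + 2 t w\<close>, which is why the quotients of the summands are taken at
    \<open>2 * t\<close>.\<close>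
  have q_add: "q (v + w) \<le> q v + q w" for v w
  proof (rule field_le_epsilon)
    fix \<epsilon> :: real assume "\<epsilon> > 0"
    obtain T1 where T1: "T1 > 0" "\<And>t. 0 < t \<Longrightarrow> t \<le> T1 \<Longrightarrow> g v t < q v + \<epsilon> / 2"
      using q_lt[of "\<epsilon> / 2" v] \<open>\<epsilon> > 0\<close> by auto
    obtain T2 where T2: "T2 > 0" "\<And>t. 0 < t \<Longrightarrow> t \<le> T2 \<Longrightarrow> g w t < q w + \<epsilon> / 2"
      using q_lt[of "\<epsilon> / 2" w] \<open>\<epsilon> > 0\<close> by auto
    define t where "t = min T1 T2 / 2"
    have t: "t > 0" "2 * t \<le> T1" "2 * t \<le> T2"
      using T1(1) T2(1) by (auto simp: t_def min_def)
    have "y + t *\<^sub>R (v + w) = (1/2) *\<^sub>R ((y + (2 * t) *\<^sub>R v) + (y + (2 * t) *\<^sub>R w))"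
      by (simp add: scaleR_add_right flip: scaleR_add_left)
    then have "norm (y + t *\<^sub>R (v + w)) \<le> (norm (y + (2 * t) *\<^sub>R v) + norm (y + (2 * t) *\<^sub>R w)) / 2"
      using norm_triangle_ineq[of "y + (2 * t) *\<^sub>R v" "y + (2 * t) *\<^sub>R w"] by simp
    then have "g (v + w) t \<le> ((norm (y + (2 * t) *\<^sub>R v) + norm (y + (2 * t) *\<^sub>R w)) / 2 - 1) / t"
      unfolding g_def using t(1) by (intro divide_right_mono) auto
    also have "\<dots> = g v (2 * t) + g w (2 * t)"
      using t(1) by (simp add: g_def field_simps)
    finally have "g (v + w) t \<le> g v (2 * t) + g w (2 * t)" .
    then show "q (v + w) \<le> q v + q w + \<epsilon>"
      using q_le[OF t(1), of "v + w"] T1(2)[of "2 * t"] T2(2)[of "2 * t"] t by auto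
  qed
  have q_scale_le: "q (a *\<^sub>R v) \<le> a * q v" if "a > 0" for a v
  proof -
    have "q (a *\<^sub>R v) / a \<le> q v"
    proof (rule q_ge)
      fix t :: real assume t: "t > 0"
      have "g (a *\<^sub>R v) (t / a) = a * g v t"
        using that by (simp add: g_def)
      then show "q (a *\<^sub>R v) / a \<le> g v t"
        using q_le[of "t / a" "a *\<^sub>R v"] t that by (simp add: field_simps)
    qed
    then show ?thesis using that by (simp add: field_simps)
  qed
  have q_scale_pos: "q (a *\<^sub>R v) = a * q v" if "a > 0" for a v
    using q_scale_le[OF that, of v] q_scale_le[of "1 / a" "a *\<^sub>R v"] that
    by (simp add: field_simps)
  have q_0: "q 0 = 0"
    using q_scale_pos[of 2 0] by simp
  \<comment> \<open>Smoothness enters here: the sum of the two opposite quotients is a second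
    difference divided by \<open>t\<close>, so the one-sided derivatives in directions
    \<open>v\<close> and \<open>- v\<close> cancel.\<close>
  have q_neg: "q (- v) = - q v" if v: "v \<in> Y" for v
  proof (cases "v = 0")
    case False
    have "q v + q (- v) \<le> 0"
    proof (rule field_le_epsilon)
      fix \<epsilon> :: real assume "\<epsilon> > 0"
      then obtain s where s: "s > 0" "\<And>u w. u \<in> Y \<Longrightarrow> w \<in> Y \<Longrightarrow> norm u = 1 \<Longrightarrow> norm w \<le> s \<Longrightarrow>
          norm (u + w) + norm (u - w) \<le> 2 + (\<epsilon> / norm v) * s"
        using uniformly_smooth_onE[OF sm, of "\<epsilon> / norm v"] False by auto
      define t where "t = s / norm v"
      have t: "t > 0" using s False by (simp add: t_def)
      have "norm (y + t *\<^sub>R v) + norm (y - t *\<^sub>R v) \<le> 2 + \<epsilon> * t"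
        using s(2)[OF y(1) subspace_scale[OF sub v] y(2), of t] s(1) False
        by (simp add: t_def)
      then have "(norm (y + t *\<^sub>R v) + norm (y - t *\<^sub>R v) - 2) / t \<le> \<epsilon>"
        using t by (simp add: pos_divide_le_eq)
      moreover have "g v t + g (- v) t = (norm (y + t *\<^sub>R v) + norm (y - t *\<^sub>R v) - 2) / t"
        by (simp add: g_def diff_divide_distrib add_divide_distrib)
      ultimately have "g v t + g (- v) t \<le> \<epsilon>" by simp
      then show "q v + q (- v) \<le> 0 + \<epsilon>"
        using q_le[OF t, of v] q_le[OF t, of "- v"] by linarith
    qed
    then show ?thesis
      using q_add[of v "- v"] q_0 by simp
  qed (simp add: q_0)
  define \<zeta> where "\<zeta> u = (if u \<in> Y then q u else 0)" for u
  have q_abs: "\<bar>q v\<bar> \<le> norm v" for v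
    using q_le[of 1 v] g_up[of 1 v] q_ge[of "- norm v" v] g_low by fastforce
  \<comment> \<open>A subadditive odd function is additive: subadditivity at \<open>- v\<close> and
    \<open>- w\<close> is the reverse inequality.\<close>
  have "q (v + w) = q v + q w" if "v \<in> Y" "w \<in> Y" for v w
    using q_add[of v w] q_add[of "- v" "- w"] q_neg[of v] q_neg[of w] q_neg[of "v + w"] that
      subspace_add[OF sub] by simp
  moreover have "q (a *\<^sub>R v) = a * q v" if "v \<in> Y" for a v
  proof (cases a "0::real" rule: linorder_cases)
    case less
    then show ?thesis
      using q_scale_pos[of "- a" v] q_neg[of "a *\<^sub>R v"] subspace_scale[OF sub that, of a] by simp
  qed (use q_0 q_scale_pos in auto)
  ultimately have "\<zeta> \<in> dual_on Y"
    unfolding dual_on_def \<zeta>_def using sub q_abs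
    by (auto simp: subspace_add subspace_scale intro!: exI[of _ 1])
  moreover have "\<zeta> y = 1"
  proof -
    have "g y t = 1" if "t > 0" for t
    proof -
      have "y + t *\<^sub>R y = (1 + t) *\<^sub>R y" by (simp add: algebra_simps)
      then show ?thesis using that y by (simp add: g_def)
    qed
    then show ?thesis
      using q_le[of 1 y] q_ge[of 1 y] y by (auto simp: \<zeta>_def)
  qed
  ultimately show thesis
    using that[of \<zeta>] q_abs y by (auto simp: norming_def \<zeta>_def)
qed

text \<open>The test quantity \<open>\<zeta> (u + h) + \<zeta>' (v - h)\<close> is at most
  \<open>norm (u + h) + norm (v - h)\<close>; replacing \<open>v\<close> by \<open>u\<close> costs
  \<open>norm (u - v)\<close> and leaves a second difference at \<open>u\<close>. The radius
  \<open>d\<close> is uniform in the base points, which gives continuity of the duality mapping and,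
  for \<open>u = v\<close>, uniqueness.\<close>

lemma norming_functionals_close:
  assumes sub: "subspace Y" and sm: "uniformly_smooth_on Y" and "\<epsilon> > 0"
  obtains d where "d > 0" and
    "\<And>u v \<zeta> \<zeta>' w. norming Y u \<zeta> \<Longrightarrow> norming Y v \<zeta>' \<Longrightarrow> norm (u - v) < d \<Longrightarrow> w \<in> Y \<Longrightarrow>
       \<bar>\<zeta> w - \<zeta>' w\<bar> \<le> \<epsilon> * norm w"
proof -
  obtain s where s: "s > 0" "\<And>u w. u \<in> Y \<Longrightarrow> w \<in> Y \<Longrightarrow> norm u = 1 \<Longrightarrow> norm w \<le> s \<Longrightarrow>
      norm (u + w) + norm (u - w) \<le> 2 + (\<epsilon> / 2) * s"
    using uniformly_smooth_onE[OF sm, of "\<epsilon> / 2"] \<open>\<epsilon> > 0\<close> by auto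
  show thesis
  proof
    \<comment> \<open>One half of \<open>\<epsilon> * s\<close> pays for smoothness, the other for
      the distance of the base points.\<close>
    show "\<epsilon> / 2 * s > 0" using s \<open>\<epsilon> > 0\<close> by simp
    fix u v \<zeta> \<zeta>' w
    assume "norming Y u \<zeta>" "norming Y v \<zeta>'" and uv: "norm (u - v) < \<epsilon> / 2 * s" and w: "w \<in> Y"
    then have u: "u \<in> Y" "norm u = 1" and v: "v \<in> Y" "norm v = 1"
      and z: "\<zeta> \<in> dual_on Y" "\<And>w. w \<in> Y \<Longrightarrow> \<bar>\<zeta> w\<bar> \<le> norm w" "\<zeta> u = 1"
      and z': "\<zeta>' \<in> dual_on Y" "\<And>w. w \<in> Y \<Longrightarrow> \<bar>\<zeta>' w\<bar> \<le> norm w" "\<zeta>' v = 1"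
      by (auto simp: norming_def)
    have one_sided: "\<zeta> h - \<zeta>' h \<le> \<epsilon> * s" if h: "h \<in> Y" "norm h \<le> s" for h
    proof -
      have "\<zeta> h - \<zeta>' h = \<zeta> (u + h) + \<zeta>' (v - h) - 2"
        using dual_on_add[OF z(1) u(1) h(1)] dual_on_diff[OF z'(1) sub v(1) h(1)] z z' by simp
      also have "\<dots> \<le> norm (u + h) + norm (v - h) - 2"
        using z(2)[OF subspace_add[OF sub u(1) h(1)]] z'(2)[OF subspace_diff[OF sub v(1) h(1)]]
        by linarith
      also have "norm (v - h) \<le> norm (u - h) + norm (u - v)"
        using norm_triangle_ineq4[of "u - h" "u - v"] by simp
      also have "norm (u + h) + (norm (u - h) + norm (u - v)) - 2 \<le> \<epsilon> * s"
        using s(2)[OF u(1) h(1) u(2) h(2)] uv by linarith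
      finally show ?thesis by simp
    qed
    have scaled: "\<bar>\<zeta> h - \<zeta>' h\<bar> \<le> \<epsilon> * s" if h: "h \<in> Y" "norm h \<le> s" for h
      using one_sided[OF h] one_sided[OF subspace_scale[OF sub h(1), of "-1"]] h
        dual_on_scaleR[OF z(1) h(1), of "-1"] dual_on_scaleR[OF z'(1) h(1), of "-1"] by simp
    show "\<bar>\<zeta> w - \<zeta>' w\<bar> \<le> \<epsilon> * norm w"
    proof (cases "w = 0")
      case True
      then show ?thesis using z(2)[OF w] z'(2)[OF w] by simp
    next
      case False
      let ?a = "s / norm w"
      have "\<bar>?a * \<zeta> w - ?a * \<zeta>' w\<bar> \<le> \<epsilon> * s"
        using scaled[OF subspace_scale[OF sub w, of ?a]] False s(1)
          dual_on_scaleR[OF z(1) w] dual_on_scaleR[OF z'(1) w] by simp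
      then have "?a * \<bar>\<zeta> w - \<zeta>' w\<bar> \<le> \<epsilon> * s"
        unfolding right_diff_distrib[symmetric] abs_mult using s(1) by simp
      then show ?thesis
        using False s(1) by (simp add: field_simps)
    qed
  qed
qed

lemma dual_norm_on_bound:
  assumes sub: "subspace Y" and z: "\<zeta> \<in> dual_on Y" and u: "u \<in> Y"
  shows "\<bar>\<zeta> u\<bar> \<le> dual_norm_on Y \<zeta> * norm u"
proof (cases "u = 0")
  case True
  then show ?thesis
    using dual_on_scaleR[OF z u, of 0] by simp
next
  case False
  obtain K where K: "\<And>u. u \<in> Y \<Longrightarrow> \<bar>\<zeta> u\<bar> \<le> K * norm u"
    using z unfolding dual_on_def by blast
  have "bdd_above ((\<lambda>u. \<bar>\<zeta> u\<bar>) ` {u \<in> Y. norm u \<le> 1})"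
  proof (rule bdd_aboveI2)
    fix u assume u: "u \<in> {u \<in> Y. norm u \<le> 1}"
    then have "K * norm u \<le> \<bar>K\<bar> * 1"
      by (intro mult_mono) auto
    then show "\<bar>\<zeta> u\<bar> \<le> \<bar>K\<bar>" using K[of u] u by simp
  qed
  then have "\<bar>\<zeta> ((1 / norm u) *\<^sub>R u)\<bar> \<le> dual_norm_on Y \<zeta>"
    unfolding dual_norm_on_def using False subspace_scale[OF sub u] by (intro cSUP_upper) auto
  then show ?thesis
    using dual_on_scaleR[OF z u] False by (simp add: abs_mult field_simps)
qed

text \<open>Rescaling by \<open>norm v powr (1 - r)\<close> turns an element of the duality mapping
  into a supporting functional at the unit vector \<open>v / norm v\<close>, to which
  \<open>norming_functionals_close\<close> applies.\<close>

lemma duality_map_unit_norming: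
  assumes "subspace Y" "\<zeta> \<in> duality_map Y r v" "v \<in> Y" "v \<noteq> 0"
  defines "c \<equiv> norm v powr (1 - r)"
  shows "norming Y ((1 / norm v) *\<^sub>R v) (\<lambda>u. c * \<zeta> u)" "\<And>u. \<zeta> u = norm v powr (r - 1) * (c * \<zeta> u)"
proof -
  have z: "\<zeta> \<in> dual_on Y" "dual_norm_on Y \<zeta> = norm v powr (r - 1)" "\<zeta> v = norm v powr r"
    using assms(2) by (auto simp: duality_map_def)
  have c: "c * norm v powr (r - 1) = 1" "c \<ge> 0"
    using assms(4) by (auto simp: c_def simp flip: powr_add)
  have 1: "(\<lambda>u. c * \<zeta> u) \<in> dual_on Y"
    using z by (intro dual_on_cmult)
  have 2: "\<bar>c * \<zeta> u\<bar> \<le> norm u" if "u \<in> Y" for u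
    using mult_left_mono[OF dual_norm_on_bound[OF assms(1) z(1) that] c(2)] z(2) c
    by (simp add: abs_mult flip: mult.assoc)
  have "norm v powr (1 - r) * norm v powr r = norm v"
    using assms(4) by (simp flip: powr_add)
  then have 3: "c * \<zeta> ((1 / norm v) *\<^sub>R v) = 1"
    using dual_on_scaleR[OF z(1) assms(3)] z(3) assms(4) by (simp add: c_def)
  show "norming Y ((1 / norm v) *\<^sub>R v) (\<lambda>u. c * \<zeta> u)"
    using 1 2 3 assms(1,3,4) by (simp add: norming_def subspace_scale)
  show "\<zeta> u = norm v powr (r - 1) * (c * \<zeta> u)" for u
    using c by (simp flip: mult.assoc) (simp add: mult.commute)
qed

text \<open>\<open>the_elem\<close> is meaningful for singletons only. Existence scales a supporting
  functional; uniqueness compares two candidates at the same base point with arbitrarily small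
  tolerance.\<close>

lemma duality_map_singleton:
  assumes sub: "subspace Y" and sm: "uniformly_smooth_on Y" and v: "v \<in> Y" and r: "r > 1"
  shows "the_elem (duality_map Y r v) \<in> duality_map Y r v"
proof -
  have ne: "{u \<in> Y. norm u \<le> 1} \<noteq> {}"
    using subspace_0[OF sub] by auto
  obtain \<zeta>0 where z0: "\<zeta>0 \<in> duality_map Y r v"
  proof (cases "v = 0")
    case True
    have "(\<lambda>_. 0) \<in> dual_on Y" by (auto simp: dual_on_def intro: exI[of _ 0])
    then show ?thesis
      using True r ne by (intro that[of "\<lambda>_. 0"]) (simp add: duality_map_def dual_norm_on_def)
  next
    case False
    define e where "e = (1 / norm v) *\<^sub>R v"
    have e: "e \<in> Y" "norm e = 1" using False subspace_scale[OF sub v] by (auto simp: e_def)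
    obtain \<zeta> where z: "\<zeta> \<in> dual_on Y" "\<And>u. u \<in> Y \<Longrightarrow> \<bar>\<zeta> u\<bar> \<le> norm u" "\<zeta> e = 1"
      using norming_functional_exists[OF sub sm e] unfolding norming_def by metis
    let ?j = "\<lambda>u. norm v powr (r - 1) * \<zeta> u"
    have j: "?j \<in> dual_on Y" using z(1) by (rule dual_on_cmult)
    have "\<bar>?j u\<bar> \<le> norm v powr (r - 1)" if "u \<in> {u \<in> Y. norm u \<le> 1}" for u
      using z(2)[of u] that by (simp add: abs_mult mult_left_le)
    then have "dual_norm_on Y ?j \<le> norm v powr (r - 1)"
      unfolding dual_norm_on_def by (intro cSUP_least ne)
    moreover have "norm v powr (r - 1) \<le> dual_norm_on Y ?j"
      using dual_norm_on_bound[OF sub j e(1)] e(2) z(3) by simp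
    moreover have "\<zeta> v = norm v"
      using z(3) dual_on_scaleR[OF z(1) v, of "1 / norm v"] False by (simp add: e_def)
    then have "?j v = norm v powr r"
      using powr_mult_base[of "norm v" "r - 1"] by (simp add: mult.commute)
    ultimately show ?thesis
      using j by (intro that[of ?j]) (simp add: duality_map_def)
  qed
  have uniq: "\<zeta> = \<zeta>'" if z: "\<zeta> \<in> duality_map Y r v" and z': "\<zeta>' \<in> duality_map Y r v" for \<zeta> \<zeta>'
  proof
    fix u
    have d: "\<zeta> \<in> dual_on Y" "\<zeta>' \<in> dual_on Y" using z z' by (auto simp: duality_map_def)
    consider "u \<notin> Y" | "u \<in> Y" "v = 0" | "u \<in> Y" "v \<noteq> 0" by blast
    then show "\<zeta> u = \<zeta>' u"
    proof cases
      case 1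
      then show ?thesis using d dual_on_outside by metis
    next
      case 2
      then show ?thesis
        using dual_norm_on_bound[OF sub d(1), of u] dual_norm_on_bound[OF sub d(2), of u] z z' r
        by (auto simp: duality_map_def)
    next
      case 3
      let ?c = "norm v powr (1 - r)"
      note n = duality_map_unit_norming[OF sub z v 3(2)] duality_map_unit_norming[OF sub z' v 3(2)]
      have "\<bar>?c * \<zeta> u - ?c * \<zeta>' u\<bar> \<le> 0"
      proof (rule field_le_epsilon)
        fix \<epsilon> :: real assume \<epsilon>: "\<epsilon> > 0"
        then have "\<epsilon> / (norm u + 1) > 0"
          by (simp add: add_nonneg_pos)
        then obtain d where "d > 0" and d: "\<And>u' v \<zeta> \<zeta>' w. norming Y u' \<zeta> \<Longrightarrow> norming Y v \<zeta>' \<Longrightarrow>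
            norm (u' - v) < d \<Longrightarrow> w \<in> Y \<Longrightarrow> \<bar>\<zeta> w - \<zeta>' w\<bar> \<le> \<epsilon> / (norm u + 1) * norm w"
          using norming_functionals_close[OF sub sm] by metis
        have "\<bar>?c * \<zeta> u - ?c * \<zeta>' u\<bar> \<le> \<epsilon> / (norm u + 1) * norm u"
          using d[OF n(1,3) _ 3(1)] \<open>d > 0\<close> by simp
        also have "\<dots> \<le> \<epsilon>"
          using \<epsilon> by (simp add: divide_le_eq add_nonneg_pos)
        finally show "\<bar>?c * \<zeta> u - ?c * \<zeta>' u\<bar> \<le> 0 + \<epsilon>" by simp
      qed
      then have "\<bar>?c * \<zeta> u - ?c * \<zeta>' u\<bar> = 0"
        by (rule antisym) (rule abs_ge_zero)
      then have eq: "?c * \<zeta> u = ?c * \<zeta>' u"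
        unfolding abs_eq_0 by (rule iffD1[OF right_minus_eq])
      have "\<zeta> u = norm v powr (r - 1) * (?c * \<zeta> u)" by (rule n(2))
      also have "\<dots> = norm v powr (r - 1) * (?c * \<zeta>' u)" by (rule arg_cong[OF eq])
      also have "\<dots> = \<zeta>' u" by (rule n(4)[symmetric])
      finally show ?thesis .
    qed
  qed
  have "duality_map Y r v = {\<zeta>0}"
  proof (intro equalityI subsetI)
    fix \<zeta> assume "\<zeta> \<in> duality_map Y r v"
    from uniq[OF this z0] show "\<zeta> \<in> {\<zeta>0}" by (rule ssubst) (rule singletonI)
  next
    fix \<zeta> assume "\<zeta> \<in> {\<zeta>0}"
    with z0 show "\<zeta> \<in> duality_map Y r v" by simp
  qed
  then show ?thesis by simp
qed

text \<open>Since \<open>\<zeta>\<close> is linear on \<open>Y\<close> only, the range of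
  \<open>A\<close> has to lie in \<open>Y\<close>; then the composition is bounded linear and
  \<open>Blinfun\<close> returns it unchanged.\<close>

lemma adjoint_on_apply:
  fixes A :: "'a::real_normed_vector \<Rightarrow>\<^sub>L 'b::real_normed_vector"
  assumes "subspace Y" "\<zeta> \<in> dual_on Y" "\<And>h. blinfun_apply A h \<in> Y"
  shows "blinfun_apply (adjoint_on A \<zeta>) h = \<zeta> (blinfun_apply A h)"
proof -
  obtain K where K: "\<And>u. u \<in> Y \<Longrightarrow> \<bar>\<zeta> u\<bar> \<le> K * norm u"
    using assms(2) unfolding dual_on_def by blast
  have "bounded_linear (\<lambda>h. \<zeta> (blinfun_apply A h))"
  proof (rule bounded_linear_intro)
    fix h :: 'a
    have "\<bar>\<zeta> (blinfun_apply A h)\<bar> \<le> \<bar>K\<bar> * norm (blinfun_apply A h)"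
      using K[OF assms(3)[of h]] mult_right_mono[OF abs_ge_self norm_ge_zero] by (rule order_trans)
    also have "\<dots> \<le> \<bar>K\<bar> * (norm A * norm h)"
      by (intro mult_left_mono norm_blinfun) auto
    finally show "norm (\<zeta> (blinfun_apply A h)) \<le> norm h * (\<bar>K\<bar> * norm A)"
      by (simp add: mult_ac)
  qed (use dual_on_add[OF assms(2)] dual_on_scaleR[OF assms(2)] assms(3) in
        \<open>auto simp: blinfun.bilinear_simps\<close>)
  then show ?thesis
    by (simp add: adjoint_on_def bounded_linear_Blinfun_apply)
qed

section \<open>The step functional: step size times duality mapping\<close>

definition active_norm :: "real \<Rightarrow> 'b::real_normed_vector \<Rightarrow> real" where
  "active_norm t v = (if norm v > t then norm v else 0)"

text \<open>Absorbs the step size into the functional, so that active and inactive updates share one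
  form as an adjoint applied to a functional.\<close>

definition step_functional ::
    "'b::real_normed_vector set \<Rightarrow> real \<Rightarrow> real \<Rightarrow> real \<Rightarrow> real \<Rightarrow> real \<Rightarrow> 'b \<Rightarrow> 'b \<Rightarrow> real" where
  "step_functional Y p r \<tau> \<mu> \<delta> v =
     (\<lambda>u. lk_stepsize p r \<tau> \<mu> \<delta> v * the_elem (duality_map Y r v) u)"

context
  fixes Y :: "'b::real_normed_vector set" and p r \<tau> \<mu> :: real
  assumes sub: "subspace Y" and sm: "uniformly_smooth_on Y"
    and r: "r > 1" and p: "p > 1" and mu: "\<mu> > 0"
begin

lemma step_functional_dual: "v \<in> Y \<Longrightarrow> step_functional Y p r \<tau> \<mu> \<delta> v \<in> dual_on Y"
  unfolding step_functional_def using duality_map_singleton[OF sub sm _ r, of v]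
  by (intro dual_on_cmult) (simp add: duality_map_def)

text \<open>The factor \<open>norm v powr (p - r)\<close> of the step size and the gauge
  \<open>norm v powr (r - 1)\<close> multiply to \<open>norm v powr (p - 1)\<close>, so the
  estimates that follow do not see \<open>r\<close>.\<close>

lemma step_functional_active:
  assumes "v \<in> Y" "norm v > \<tau> * \<delta>" "v \<noteq> 0"
  obtains \<zeta> where "norming Y ((1 / norm v) *\<^sub>R v) \<zeta>"
    "\<And>u. step_functional Y p r \<tau> \<mu> \<delta> v u = \<mu> * norm v powr (p - 1) * \<zeta> u"
proof -
  let ?j = "the_elem (duality_map Y r v)"
  have j: "?j \<in> duality_map Y r v"
    by (rule duality_map_singleton[OF sub sm assms(1) r])
  note n = duality_map_unit_norming[OF sub j assms(1,3)]
  have "step_functional Y p r \<tau> \<mu> \<delta> v u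
      = \<mu> * (norm v powr (p - r) * norm v powr (r - 1)) * (norm v powr (1 - r) * ?j u)" for u
    using assms(2) n(2)[of u] unfolding step_functional_def lk_stepsize_def
    by (simp add: mult.assoc)
  then show thesis
    using that[OF n(1)] by (simp flip: powr_add)
qed

lemma step_functional_bound:
  assumes "v \<in> Y" "u \<in> Y"
  shows "\<bar>step_functional Y p r \<tau> \<mu> \<delta> v u\<bar> \<le> \<mu> * active_norm (\<tau> * \<delta>) v powr (p - 1) * norm u"
proof (cases "norm v > \<tau> * \<delta> \<and> v \<noteq> 0")
  case True
  then obtain \<zeta> where z: "norming Y ((1 / norm v) *\<^sub>R v) \<zeta>"
    "\<And>u. step_functional Y p r \<tau> \<mu> \<delta> v u = \<mu> * norm v powr (p - 1) * \<zeta> u"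
    using step_functional_active assms(1) by blast
  then have "\<bar>\<zeta> u\<bar> \<le> norm u" using assms(2) by (simp add: norming_def)
  then show ?thesis
    using z(2) True mu by (auto simp: active_norm_def abs_mult intro!: mult_left_mono)
next
  case False
  then show ?thesis
    by (auto simp: step_functional_def lk_stepsize_def active_norm_def)
qed

lemma step_functional_self:
  assumes "v \<in> Y"
  shows "step_functional Y p r \<tau> \<mu> \<delta> v v = \<mu> * active_norm (\<tau> * \<delta>) v powr p"
proof (cases "norm v > \<tau> * \<delta> \<and> v \<noteq> 0")
  case True
  then obtain \<zeta> where z: "norming Y ((1 / norm v) *\<^sub>R v) \<zeta>"
    "\<And>u. step_functional Y p r \<tau> \<mu> \<delta> v u = \<mu> * norm v powr (p - 1) * \<zeta> u"
    using step_functional_active assms(1) by blast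
  have "\<zeta> v = norm v"
    using z(1) dual_on_scaleR[of \<zeta> Y v "1 / norm v"] assms True by (simp add: norming_def)
  then show ?thesis
    using z(2)[of v] True powr_mult_base[of "norm v" "p - 1"] by (simp add: active_norm_def mult_ac)
next
  case False
  then show ?thesis
    by (auto simp: step_functional_def lk_stepsize_def active_norm_def)
qed

text \<open>At \<open>v\<^sub>0 = 0\<close> the direction \<open>v / norm v\<close> has no limit, but the factor \<open>norm v powr (p - 1)\<close>
  vanishes there.\<close>

lemma step_functional_tendsto:
  assumes v: "(v \<longlongrightarrow> v0) f" "eventually (\<lambda>k. v k \<in> Y) f" "v0 \<in> Y" and d: "(\<delta> \<longlongrightarrow> 0) f" and "\<epsilon> > 0"
  shows "eventually (\<lambda>k. \<forall>u\<in>Y. \<bar>step_functional Y p r \<tau> \<mu> (\<delta> k) (v k) u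
           - step_functional Y p r \<tau> \<mu> 0 v0 u\<bar> \<le> \<epsilon> * norm u) f"
proof (cases "v0 = 0")
  case True
  have "((\<lambda>k. \<mu> * norm (v k) powr (p - 1)) \<longlongrightarrow> 0) f"
    using v(1) True p
    by (intro tendsto_mult_right_zero tendsto_zero_powrI[where b = "p - 1"]) (auto intro: tendsto_norm_zero)
  then have "eventually (\<lambda>k. \<mu> * norm (v k) powr (p - 1) < \<epsilon>) f"
    using \<open>\<epsilon> > 0\<close> by (auto simp: order_tendsto_iff)
  with v(2) show ?thesis
  proof eventually_elim
    case (elim k)
    show ?case
    proof
      fix u assume u: "u \<in> Y"
      have "\<bar>step_functional Y p r \<tau> \<mu> (\<delta> k) (v k) u\<bar>
          \<le> \<mu> * active_norm (\<tau> * \<delta> k) (v k) powr (p - 1) * norm u"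
        by (rule step_functional_bound[OF elim(1) u])
      also have "\<dots> \<le> \<mu> * norm (v k) powr (p - 1) * norm u"
        using mu p by (intro mult_right_mono mult_left_mono powr_mono2) (auto simp: active_norm_def)
      also have "\<dots> \<le> \<epsilon> * norm u"
        using elim(2) by (intro mult_right_mono) auto
      finally show "\<bar>step_functional Y p r \<tau> \<mu> (\<delta> k) (v k) u - step_functional Y p r \<tau> \<mu> 0 v0 u\<bar>
          \<le> \<epsilon> * norm u"
        using True by (simp add: step_functional_def[of _ _ _ _ _ 0] lk_stepsize_def)
    qed
  qed
next
  case False
  define a0 where "a0 = \<mu> * norm v0 powr (p - 1)"
  define a where "a k = \<mu> * norm (v k) powr (p - 1)" for k
  have a0: "a0 > 0" using False mu by (simp add: a0_def)
  \<comment> \<open>The tolerance is chosen for the product estimate below: after multiplication by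
    \<open>a0\<close> the direction error contributes half of \<open>\<epsilon>\<close>, and the
    amplitude error \<open>a k - a0\<close> the other half.\<close>
  obtain c where "c > 0" and c: "\<And>u v \<zeta> \<zeta>' w. norming Y u \<zeta> \<Longrightarrow> norming Y v \<zeta>' \<Longrightarrow>
      norm (u - v) < c \<Longrightarrow> w \<in> Y \<Longrightarrow> \<bar>\<zeta> w - \<zeta>' w\<bar> \<le> \<epsilon> / (2 * a0) * norm w"
    using norming_functionals_close[OF sub sm, of "\<epsilon> / (2 * a0)"] \<open>\<epsilon> > 0\<close> a0
    by (metis divide_pos_pos zero_less_mult_iff zero_less_numeral)
  obtain \<zeta>0 where z0: "norming Y ((1 / norm v0) *\<^sub>R v0) \<zeta>0"
    "\<And>u. step_functional Y p r \<tau> \<mu> 0 v0 u = a0 * \<zeta>0 u"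
    using step_functional_active[of v0 0] v(3) False unfolding a0_def by auto
  have "(a \<longlongrightarrow> a0) f"
    unfolding a_def a0_def using v(1) False by (intro tendsto_intros) auto
  then have ev1: "eventually (\<lambda>k. \<bar>a k - a0\<bar> < \<epsilon> / 2) f"
    using tendstoD[of a a0 f "\<epsilon> / 2"] \<open>\<epsilon> > 0\<close> by (simp add: dist_real_def)
  have "((\<lambda>k. (1 / norm (v k)) *\<^sub>R v k) \<longlongrightarrow> (1 / norm v0) *\<^sub>R v0) f"
    using v(1) False by (intro tendsto_intros) auto
  then have ev2: "eventually (\<lambda>k. norm ((1 / norm (v k)) *\<^sub>R v k - (1 / norm v0) *\<^sub>R v0) < c) f"
    using \<open>c > 0\<close> by (auto simp: tendsto_iff dist_norm)
  \<comment> \<open>The limit residual is nonzero while the threshold tends to 0, so the step is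
    eventually active and \<open>step_functional_active\<close> describes it.\<close>
  have "((\<lambda>k. norm (v k) - \<tau> * \<delta> k) \<longlongrightarrow> norm v0 - \<tau> * 0) f"
    using v(1) d by (intro tendsto_intros)
  then have ev3: "eventually (\<lambda>k. norm (v k) - \<tau> * \<delta> k > 0) f"
    using False by (intro order_tendstoD(1)) auto
  have "eventually (\<lambda>k. v k \<noteq> 0) f"
    using v(1) False by (rule tendsto_imp_eventually_ne)
  with ev1 ev2 ev3 v(2) show ?thesis
  proof eventually_elim
    case (elim k)
    then obtain \<zeta> where z: "norming Y ((1 / norm (v k)) *\<^sub>R v k) \<zeta>"
      "\<And>u. step_functional Y p r \<tau> \<mu> (\<delta> k) (v k) u = a k * \<zeta> u"
      using step_functional_active[of "v k" "\<delta> k"] unfolding a_def by auto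
    show ?case
    proof
      fix u assume u: "u \<in> Y"
      have "\<bar>a k * \<zeta> u - a0 * \<zeta>0 u\<bar> = \<bar>(a k - a0) * \<zeta> u + a0 * (\<zeta> u - \<zeta>0 u)\<bar>"
        by (simp add: algebra_simps)
      also have "\<dots> \<le> \<bar>a k - a0\<bar> * \<bar>\<zeta> u\<bar> + a0 * \<bar>\<zeta> u - \<zeta>0 u\<bar>"
        using a0 by (metis abs_mult abs_of_pos abs_triangle_ineq)
      also have "\<dots> \<le> \<epsilon> / 2 * norm u + a0 * (\<epsilon> / (2 * a0) * norm u)"
        using elim(1) z(1) u c[OF z(1) z0(1) elim(2) u] a0
          \<open>\<epsilon> > 0\<close> by (intro add_mono mult_mono) (auto simp: norming_def)
      also have "\<dots> = \<epsilon> * norm u"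
        using a0 by simp
      finally show "\<bar>step_functional Y p r \<tau> \<mu> (\<delta> k) (v k) u - step_functional Y p r \<tau> \<mu> 0 v0 u\<bar>
          \<le> \<epsilon> * norm u"
        unfolding z(2) z0(2) .
    qed
  qed
qed

lemma lk_update_eq:
  assumes "v \<in> Y" "\<And>h. blinfun_apply A h \<in> Y"
  shows "lk_stepsize p r \<tau> \<mu> \<delta> v *\<^sub>R adjoint_on A (the_elem (duality_map Y r v))
       = adjoint_on A (step_functional Y p r \<tau> \<mu> \<delta> v)"
proof (rule blinfun_eqI)
  fix h
  have j: "the_elem (duality_map Y r v) \<in> dual_on Y"
    using duality_map_singleton[OF sub sm assms(1) r] by (simp add: duality_map_def)
  show "blinfun_apply (lk_stepsize p r \<tau> \<mu> \<delta> v *\<^sub>R adjoint_on A (the_elem (duality_map Y r v))) h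
      = blinfun_apply (adjoint_on A (step_functional Y p r \<tau> \<mu> \<delta> v)) h"
    unfolding scaleR_blinfun.rep_eq adjoint_on_apply[OF sub j assms(2)]
      adjoint_on_apply[OF sub step_functional_dual[OF assms(1)] assms(2)]
    by (simp add: step_functional_def)
qed

text \<open>The difference splits into the change of the operator, tested by a functional of norm at
  most \<open>\<epsilon> + K\<close>, and the change of the functional on the range of
  \<open>A0\<close>; each gets half of \<open>e\<close>.\<close>

lemma lk_update_tendsto:
  assumes v: "(v \<longlongrightarrow> v0) f" "eventually (\<lambda>k. v k \<in> Y) f" "v0 \<in> Y" and d: "(\<delta> \<longlongrightarrow> 0) f"
    and A: "(A \<longlongrightarrow> A0) f" "eventually (\<lambda>k. \<forall>h. blinfun_apply (A k) h \<in> Y) f" "\<And>h. blinfun_apply A0 h \<in> Y"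
  shows "((\<lambda>k. adjoint_on (A k) (step_functional Y p r \<tau> \<mu> (\<delta> k) (v k)))
           \<longlongrightarrow> adjoint_on A0 (step_functional Y p r \<tau> \<mu> 0 v0)) f"
proof (rule tendstoI)
  fix e :: real assume e: "e > 0"
  define K where "K = \<mu> * norm v0 powr (p - 1)"
  define \<epsilon> where "\<epsilon> = e / 2 / (norm A0 + 1)"
  have K: "K \<ge> 0" using mu by (simp add: K_def)
  have n: "norm A0 + 1 > 0" by (simp add: add_nonneg_pos)
  then have "\<epsilon> > 0" unfolding \<epsilon>_def using e by (intro divide_pos_pos) auto
  moreover have "\<epsilon> * (norm A0 + 1) = e / 2"
    unfolding \<epsilon>_def using n by (intro nonzero_eq_divide_eq[THEN iffD1]) auto
  ultimately have eps: "\<epsilon> > 0" "\<epsilon> * norm A0 \<le> e / 2"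
    by (auto simp: algebra_simps)
  have "eventually (\<lambda>k. dist (A k) A0 < min 1 (e / 2 / (\<epsilon> + K + 1))) f"
    using A(1) e eps K by (intro tendstoD) (auto intro!: divide_pos_pos)
  with step_functional_tendsto[OF v d eps(1)] v(2) A(2) show "eventually (\<lambda>k. dist (adjoint_on (A k) (step_functional Y p r \<tau> \<mu> (\<delta> k) (v k)))
      (adjoint_on A0 (step_functional Y p r \<tau> \<mu> 0 v0)) < e) f"
  proof eventually_elim
    case (elim k)
    let ?s = "step_functional Y p r \<tau> \<mu> (\<delta> k) (v k)" and ?t = "step_functional Y p r \<tau> \<mu> 0 v0"
    have vk: "v k \<in> Y" and Ak: "\<And>h. blinfun_apply (A k) h \<in> Y" using elim by auto
    have dist: "norm (A k - A0) < e / 2 / (\<epsilon> + K + 1)" using elim by (simp add: dist_norm)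
    have "norm (adjoint_on (A k) ?s - adjoint_on A0 ?t) \<le> (\<epsilon> + K) * norm (A k - A0) + \<epsilon> * norm A0"
    proof (rule norm_blinfun_bound)
      fix h
      have in_Y: "blinfun_apply (A k - A0) h \<in> Y"
        using Ak A(3) subspace_diff[OF sub] by (simp add: blinfun.diff_left)
      have "?s (blinfun_apply (A k) h) = ?s (blinfun_apply (A k - A0) h) + ?s (blinfun_apply A0 h)"
        using dual_on_diff[OF step_functional_dual sub Ak A(3), OF vk]
        by (simp add: blinfun.diff_left)
      then have "blinfun_apply (adjoint_on (A k) ?s - adjoint_on A0 ?t) h
          = ?s (blinfun_apply (A k - A0) h) + (?s (blinfun_apply A0 h) - ?t (blinfun_apply A0 h))"
        using adjoint_on_apply[OF sub step_functional_dual[OF vk] Ak]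
          adjoint_on_apply[OF sub step_functional_dual[OF v(3)] A(3)]
        by (simp add: blinfun.diff_left)
      moreover have "\<bar>?s (blinfun_apply (A k - A0) h)\<bar> \<le> (\<epsilon> + K) * norm (blinfun_apply (A k - A0) h)"
      proof -
        have "active_norm (\<tau> * 0) v0 powr (p - 1) \<le> norm v0 powr (p - 1)"
          using p by (intro powr_mono2) (auto simp: active_norm_def)
        then have "\<mu> * active_norm (\<tau> * 0) v0 powr (p - 1) * norm (blinfun_apply (A k - A0) h)
            \<le> K * norm (blinfun_apply (A k - A0) h)"
          unfolding K_def using mu by (intro mult_right_mono mult_left_mono) auto
        then have "\<bar>?t (blinfun_apply (A k - A0) h)\<bar> \<le> K * norm (blinfun_apply (A k - A0) h)"
          using step_functional_bound[OF v(3) in_Y, of 0] by linarith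
        then show ?thesis
          using bspec[OF elim(1) in_Y] by (simp add: algebra_simps)
      qed
      moreover have "(\<epsilon> + K) * norm (blinfun_apply (A k - A0) h) \<le> (\<epsilon> + K) * (norm (A k - A0) * norm h)"
        using eps K by (intro mult_left_mono norm_blinfun) auto
      moreover have "\<bar>?s (blinfun_apply A0 h) - ?t (blinfun_apply A0 h)\<bar> \<le> \<epsilon> * norm (blinfun_apply A0 h)"
        using elim(1) A(3) by auto
      moreover have "\<epsilon> * norm (blinfun_apply A0 h) \<le> \<epsilon> * (norm A0 * norm h)"
        using eps by (intro mult_left_mono norm_blinfun) auto
      ultimately show "norm (blinfun_apply (adjoint_on (A k) ?s - adjoint_on A0 ?t) h)
          \<le> ((\<epsilon> + K) * norm (A k - A0) + \<epsilon> * norm A0) * norm h"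
        by (simp add: algebra_simps)
    qed (use eps K in auto)
    also have "(\<epsilon> + K) * norm (A k - A0) < e / 2"
    proof -
      have "(\<epsilon> + K) * norm (A k - A0) \<le> (\<epsilon> + K + 1) * norm (A k - A0)"
        by (intro mult_right_mono) auto
      also have "\<dots> < e / 2"
        using dist eps K by (simp add: pos_less_divide_eq algebra_simps)
      finally show ?thesis .
    qed
    finally show ?case
      using eps(2) by (simp add: dist_norm)
  qed
qed

end

section \<open>Minimisers of tilted convex functionals\<close>

lemma lower_semicontinuous_eventually:
  assumes "lower_semicontinuous \<Theta>" "c < \<Theta> x"
  shows "eventually (\<lambda>z. c < \<Theta> z) (nhds x)"
  using assms unfolding lower_semicontinuous_def le_Liminf_iff eventually_nhds_conv_at by blast

lemma lower_semicontinuous_limit: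
  assumes "lower_semicontinuous \<Theta>" "u \<longlonglongrightarrow> x" "\<And>n. \<Theta> (u n) \<le> ereal (b n)" "b \<longlonglongrightarrow> B"
  shows "\<Theta> x \<le> ereal B"
proof (rule ccontr)
  assume "\<not> \<Theta> x \<le> ereal B"
  then obtain c where c: "ereal B < ereal c" "ereal c < \<Theta> x"
    using ereal_dense2[of "ereal B" "\<Theta> x"] by (metis not_le)
  have "eventually (\<lambda>n. ereal c < \<Theta> (u n)) sequentially"
    using lower_semicontinuous_eventually[OF assms(1) c(2)] assms(2)
    by (rule eventually_compose_filterlim)
  moreover have "eventually (\<lambda>n. b n < c) sequentially"
    using assms(4) c(1) by (intro order_tendstoD(2)) auto
  ultimately have "eventually (\<lambda>n. False) sequentially"
  proof eventually_elim
    case (elim n)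
    then show ?case using assms(3)[of n] by (metis ereal_less_eq(3) leD less_le_trans order.strict_implies_order not_less)
  qed
  then show False by simp
qed

locale tilted_convex =
  fixes \<Theta> :: "'a::banach \<Rightarrow> ereal" and p c0 :: real
  assumes p_ge: "p \<ge> 2" and Theta_proper: "proper_fun \<Theta>"
    and Theta_lsc: "lower_semicontinuous \<Theta>" and Theta_pconvex: "p_convex p \<Theta>"
    and c0_pos: "c0 > 0"
    and Theta_bregman: "\<And>x' x \<xi>. x \<in> dom_subdifferential \<Theta> \<Longrightarrow> \<xi> \<in> subdifferential \<Theta> x \<Longrightarrow>
           bregman \<Theta> \<xi> x' x \<ge> ereal (c0 * norm (x' - x) powr p)"
begin

text \<open>Real copy of \<open>\<Theta>\<close>, faithful on \<open>dom_fun \<Theta>\<close> only;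
  where \<open>\<Theta>\<close> is infinite, \<open>real_of_ereal\<close> returns 0.\<close>

definition \<theta> :: "'a \<Rightarrow> real" where "\<theta> x = real_of_ereal (\<Theta> x)"

lemma Theta_real: "x \<in> dom_fun \<Theta> \<Longrightarrow> \<Theta> x = ereal (\<theta> x)"
  using Theta_proper unfolding proper_fun_def dom_fun_def \<theta>_def
  by (cases "\<Theta> x") auto

lemma Theta_outside: "x \<notin> dom_fun \<Theta> \<Longrightarrow> \<Theta> x = \<infinity>"
  by (auto simp: dom_fun_def)

lemma dom_funI: "\<Theta> x \<le> ereal b \<Longrightarrow> x \<in> dom_fun \<Theta>"
  by (auto simp: dom_fun_def)

lemma theta_convex:
  obtains c where "c > 0" and
    "\<And>x x' l. x \<in> dom_fun \<Theta> \<Longrightarrow> x' \<in> dom_fun \<Theta> \<Longrightarrow> 0 < l \<Longrightarrow> l < 1 \<Longrightarrow>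
       l *\<^sub>R x' + (1 - l) *\<^sub>R x \<in> dom_fun \<Theta> \<and>
       \<theta> (l *\<^sub>R x' + (1 - l) *\<^sub>R x) + l * (1 - l) * c * norm (x' - x) powr p \<le> l * \<theta> x' + (1 - l) * \<theta> x"
proof -
  obtain c where c: "c > 0" "\<And>x x' l. 0 < l \<Longrightarrow> l < 1 \<Longrightarrow>
     \<Theta> (l *\<^sub>R x' + (1 - l) *\<^sub>R x) + ereal (l * (1 - l) * c * norm (x' - x) powr p)
       \<le> ereal l * \<Theta> x' + ereal (1 - l) * \<Theta> x"
    using Theta_pconvex unfolding p_convex_def by auto
  show thesis
  proof
    fix x x' and l :: real assume x: "x \<in> dom_fun \<Theta>" "x' \<in> dom_fun \<Theta>" "0 < l" "l < 1"
    let ?z = "l *\<^sub>R x' + (1 - l) *\<^sub>R x"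
    have le: "\<Theta> ?z + ereal (l * (1 - l) * c * norm (x' - x) powr p) \<le> ereal (l * \<theta> x' + (1 - l) * \<theta> x)"
      using c(2)[OF x(3,4), of x' x] x(1,2) by (simp add: Theta_real)
    then have "?z \<in> dom_fun \<Theta>"
      by (cases "\<Theta> ?z") (auto simp: dom_fun_def)
    then show "?z \<in> dom_fun \<Theta> \<and>
       \<theta> ?z + l * (1 - l) * c * norm (x' - x) powr p \<le> l * \<theta> x' + (1 - l) * \<theta> x"
      using le by (simp add: Theta_real)
  qed (rule c(1))
qed

text \<open>Lower semicontinuity bounds \<open>\<Theta>\<close> near a point of its domain, and \<open>p\<close>-convexity
  propagates this bound along rays into superlinear growth, so no affine minorant is needed.\<close>

lemma tilted_bdd_below: "\<exists>B. \<forall>x\<in>dom_fun \<Theta>. B \<le> \<theta> x - blinfun_apply \<xi> x"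
proof -
  obtain z where z: "z \<in> dom_fun \<Theta>" using Theta_proper by (auto simp: proper_fun_def)
  obtain c where c: "c > 0" and
    cvx: "\<And>x x' l. x \<in> dom_fun \<Theta> \<Longrightarrow> x' \<in> dom_fun \<Theta> \<Longrightarrow> 0 < l \<Longrightarrow> l < 1 \<Longrightarrow>
       l *\<^sub>R x' + (1 - l) *\<^sub>R x \<in> dom_fun \<Theta> \<and>
       \<theta> (l *\<^sub>R x' + (1 - l) *\<^sub>R x) + l * (1 - l) * c * norm (x' - x) powr p \<le> l * \<theta> x' + (1 - l) * \<theta> x"
    using theta_convex by blast
  have "ereal (\<theta> z - 1) < \<Theta> z" using Theta_real[OF z] by simp
  from lower_semicontinuous_eventually[OF Theta_lsc this]
  obtain \<epsilon> where eps: "\<epsilon> > 0" and near: "\<And>x. dist x z < \<epsilon> \<Longrightarrow> ereal (\<theta> z - 1) < \<Theta> x"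
    by (auto simp: eventually_nhds_metric)
  \<comment> \<open>Collects two linear losses: slope \<open>2 / \<epsilon>\<close> from dividing
    the local bound by \<open>l\<close>, and \<open>norm \<xi>\<close> from the tilt.\<close>
  define K where "K = 2 / \<epsilon> + norm \<xi>"
  have K: "K \<ge> 0" using eps by (simp add: K_def)
  define B where "B = \<theta> z - blinfun_apply \<xi> z - 1 - norm \<xi> * \<epsilon> - K - K\<^sup>2 / (2 * c)"
  have K2: "K\<^sup>2 / (2 * c) \<ge> 0" using c by simp
  have "B \<le> \<theta> x - blinfun_apply \<xi> x" if x: "x \<in> dom_fun \<Theta>" for x
  proof -
    define d where "d = norm (x - z)"
    have "blinfun_apply \<xi> x - blinfun_apply \<xi> z \<le> norm \<xi> * d"
      using norm_blinfun[of \<xi> "x - z"] by (simp add: blinfun.diff_right d_def)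
    then have xi: "blinfun_apply \<xi> x \<le> blinfun_apply \<xi> z + norm \<xi> * d" by simp
    show ?thesis
    proof (cases "d < \<epsilon>")
      case True
      then have "\<theta> z - 1 < \<theta> x"
        using near[of x] Theta_real[OF x] by (simp add: d_def dist_norm)
      moreover have "norm \<xi> * d \<le> norm \<xi> * \<epsilon>" using True by (intro mult_left_mono) auto
      ultimately show ?thesis using xi K K2 by (simp add: B_def)
    next
      case False
      \<comment> \<open>Puts \<open>w\<close> at distance \<open>\<epsilon> / 2\<close> from
        \<open>z\<close>, inside the neighbourhood where the local lower bound holds.\<close>
      define l where "l = \<epsilon> / (2 * d)"
      have d: "d \<ge> \<epsilon>" "d > 0" using False eps by auto
      have l: "0 < l" "l \<le> 1 / 2" "l < 1" "l * d = \<epsilon> / 2"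
        using d eps by (auto simp: l_def field_simps)
      define w where "w = l *\<^sub>R x + (1 - l) *\<^sub>R z"
      have "w - z = l *\<^sub>R (x - z)" by (simp add: w_def algebra_simps)
      then have "dist w z = \<epsilon> / 2" using l by (simp add: dist_norm d_def)
      then have "ereal (\<theta> z - 1) < \<Theta> w" using near[of w] eps by simp
      moreover have w: "w \<in> dom_fun \<Theta>" "\<theta> w + l * (1 - l) * c * d powr p \<le> l * \<theta> x + (1 - l) * \<theta> z"
        using cvx[OF z x l(1,3)] by (auto simp: w_def d_def)
      ultimately have "\<theta> z - 1 + l * (1 - l) * c * d powr p \<le> l * \<theta> x + (1 - l) * \<theta> z"
        using Theta_real[OF w(1)] by simp
      then have "l * (\<theta> z + (1 - l) * c * d powr p) \<le> l * (\<theta> x + 1 / l)"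
        using l(1) by (simp add: algebra_simps)
      then have "\<theta> z + (1 - l) * c * d powr p \<le> \<theta> x + 1 / l"
        using l(1) by simp
      moreover have "1 / 2 * c * d powr p \<le> (1 - l) * c * d powr p"
        using l(2) c by (intro mult_right_mono) auto
      moreover have "1 / l = 2 / \<epsilon> * d" by (simp add: l_def)
      moreover have "K * d = 2 / \<epsilon> * d + norm \<xi> * d" by (simp add: K_def algebra_simps)
      ultimately have low: "\<theta> x - blinfun_apply \<xi> x \<ge> \<theta> z - blinfun_apply \<xi> z + (c / 2 * d powr p - K * d)"
        using xi by simp
      \<comment> \<open>\<open>p \<ge> 2\<close> gives quadratic growth once
        \<open>d \<ge> 1\<close>, and completing the square yields the bound; for smaller
        \<open>d\<close> the linear term is at most \<open>K\<close>.\<close>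
      have "c / 2 * d powr p - K * d \<ge> - K - K\<^sup>2 / (2 * c)"
      proof (cases "d \<ge> 1")
        case True
        then have "d\<^sup>2 \<le> d powr p"
          using powr_mono[of 2 p d] p_ge d by (simp add: powr_numeral)
        then have "c / 2 * d\<^sup>2 \<le> c / 2 * d powr p" using c by (intro mult_left_mono) auto
        moreover have "c / 2 * d\<^sup>2 - K * d + K\<^sup>2 / (2 * c) = (c * d - K)\<^sup>2 / (2 * c)"
          using c by (simp add: power2_eq_square field_simps)
        then have "c / 2 * d\<^sup>2 - K * d + K\<^sup>2 / (2 * c) \<ge> 0" using c by simp
        ultimately show ?thesis using K by linarith
      next
        case False
        then have "K * d \<le> K" using K d by (intro mult_left_le) auto
        moreover have "c / 2 * d powr p \<ge> 0" using c by simp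
        ultimately show ?thesis using K2 by linarith
      qed
      moreover have "norm \<xi> * \<epsilon> \<ge> 0" using eps by simp
      ultimately show ?thesis using low by (simp add: B_def)
    qed
  qed
  then show ?thesis by blast
qed

text \<open>Direct method in the norm topology: \<open>p\<close>-convexity at midpoints makes a
  minimising sequence Cauchy, completeness gives a limit, and lower semicontinuity shows that the
  limit is a minimiser.\<close>

lemma tilted_has_min:
  obtains x where "x \<in> dom_fun \<Theta>" "\<And>z. z \<in> dom_fun \<Theta> \<Longrightarrow> \<theta> x - blinfun_apply \<xi> x \<le> \<theta> z - blinfun_apply \<xi> z"
proof -
  define g where "g x = \<theta> x - blinfun_apply \<xi> x" for x
  define m where "m = Inf (g ` dom_fun \<Theta>)"
  obtain c where c: "c > 0" and
    cvx: "\<And>x x' l. x \<in> dom_fun \<Theta> \<Longrightarrow> x' \<in> dom_fun \<Theta> \<Longrightarrow> 0 < l \<Longrightarrow> l < 1 \<Longrightarrow>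
       l *\<^sub>R x' + (1 - l) *\<^sub>R x \<in> dom_fun \<Theta> \<and>
       \<theta> (l *\<^sub>R x' + (1 - l) *\<^sub>R x) + l * (1 - l) * c * norm (x' - x) powr p \<le> l * \<theta> x' + (1 - l) * \<theta> x"
    using theta_convex by blast
  have ne: "g ` dom_fun \<Theta> \<noteq> {}" using Theta_proper by (auto simp: proper_fun_def)
  have bdd: "bdd_below (g ` dom_fun \<Theta>)"
    using tilted_bdd_below[of \<xi>] unfolding g_def bdd_below_def by blast
  have m_le: "m \<le> g x" if "x \<in> dom_fun \<Theta>" for x
    unfolding m_def using that bdd by (intro cInf_lower) auto
  have "\<exists>x\<in>dom_fun \<Theta>. g x < m + inverse (real (Suc n))" for n
  proof -
    have "Inf (g ` dom_fun \<Theta>) < m + inverse (real (Suc n))" by (simp add: m_def)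
    from cInf_lessD[OF ne this] show ?thesis by blast
  qed
  then obtain u where u: "\<And>n. u n \<in> dom_fun \<Theta>" "\<And>n. g (u n) < m + inverse (real (Suc n))"
    by metis
  have gap: "c / 4 * norm (u a - u b) powr p \<le> inverse (real (Suc n))" if "a \<ge> n" "b \<ge> n" for a b n
  proof -
    define w where "w = (1/2) *\<^sub>R u a + (1 - 1/2) *\<^sub>R u b"
    have w: "w \<in> dom_fun \<Theta>" "\<theta> w + 1/2 * (1 - 1/2) * c * norm (u a - u b) powr p
        \<le> 1/2 * \<theta> (u a) + (1 - 1/2) * \<theta> (u b)"
      using cvx[OF u(1)[of b] u(1)[of a], of "1/2"] unfolding w_def by auto
    have "g w + c / 4 * norm (u a - u b) powr p \<le> (g (u a) + g (u b)) / 2"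
      using w(2) by (simp add: g_def w_def blinfun.bilinear_simps field_simps)
    moreover define i where "i k = inverse (real (Suc k))" for k
    have "i a \<le> i n" "i b \<le> i n"
      using that by (auto simp: i_def intro!: le_imp_inverse_le)
    moreover have "g (u a) < m + i a" "g (u b) < m + i b"
      using u(2) by (auto simp: i_def)
    ultimately have "c / 4 * norm (u a - u b) powr p \<le> i n"
      using m_le[OF w(1)] by (simp add: field_simps)
    then show ?thesis by (simp add: i_def)
  qed
  have "Cauchy u"
  proof (rule CauchyI)
    fix e :: real assume e: "e > 0"
    then have "c / 4 * e powr p > 0" using c by simp
    then obtain n where n: "inverse (real (Suc n)) < c / 4 * e powr p"
      using reals_Archimedean by blast
    show "\<exists>M. \<forall>a\<ge>M. \<forall>b\<ge>M. norm (u a - u b) < e"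
    proof (intro exI allI impI)
      fix a b assume "a \<ge> n" "b \<ge> n"
      from gap[OF this] n have "c / 4 * norm (u a - u b) powr p < c / 4 * e powr p" by linarith
      then have "norm (u a - u b) powr p < e powr p" using c by simp
      then show "norm (u a - u b) < e"
        using powr_less_cancel2[of p "norm (u a - u b)" e] p_ge e by (cases "u a = u b") auto
    qed
  qed
  then obtain x where x: "u \<longlonglongrightarrow> x" using Cauchy_convergent convergent_def by blast
  have "\<Theta> x \<le> ereal (m + 0 + blinfun_apply \<xi> x)"
  proof (rule lower_semicontinuous_limit[OF Theta_lsc x])
    show "\<Theta> (u n) \<le> ereal (m + inverse (real (Suc n)) + blinfun_apply \<xi> (u n))" for n
      using u(2)[of n] Theta_real[OF u(1)] by (simp add: g_def)
    show "(\<lambda>n. m + inverse (real (Suc n)) + blinfun_apply \<xi> (u n)) \<longlonglongrightarrow> m + 0 + blinfun_apply \<xi> x"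
      by (intro tendsto_intros LIMSEQ_inverse_real_of_nat x)
  qed
  then have le: "\<Theta> x \<le> ereal (m + blinfun_apply \<xi> x)" by simp
  then have "x \<in> dom_fun \<Theta>" by (rule dom_funI)
  moreover from this have "g x \<le> m"
    using le Theta_real by (simp add: g_def)
  ultimately show thesis
    using that[of x] m_le unfolding g_def by force
qed

section \<open>The minimiser map and Bregman distances from its values\<close>

abbreviation X :: "('a \<Rightarrow>\<^sub>L real) \<Rightarrow> 'a" where "X \<xi> \<equiv> argmin_tilted \<Theta> \<xi>"

lemma argmin_tilted:
  shows X_dom: "X \<xi> \<in> dom_fun \<Theta>"
    and X_min: "z \<in> dom_fun \<Theta> \<Longrightarrow> \<theta> (X \<xi>) - blinfun_apply \<xi> (X \<xi>) \<le> \<theta> z - blinfun_apply \<xi> z"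
proof -
  let ?f = "\<lambda>x. \<Theta> x - ereal (blinfun_apply \<xi> x)"
  obtain x where x: "x \<in> dom_fun \<Theta>" "\<And>z. z \<in> dom_fun \<Theta> \<Longrightarrow> \<theta> x - blinfun_apply \<xi> x \<le> \<theta> z - blinfun_apply \<xi> z"
    using tilted_has_min[of \<xi>] by blast
  have "?f x \<le> ?f z" for z
    using x Theta_outside[of z] by (cases "z \<in> dom_fun \<Theta>") (auto simp: Theta_real)
  then have "is_arg_min ?f (\<lambda>_. True) x" by (auto simp: is_arg_min_def not_less)
  then have "is_arg_min ?f (\<lambda>_. True) (X \<xi>)"
    unfolding argmin_tilted_def arg_min_def by (rule someI)
  then have le: "?f (X \<xi>) \<le> ?f z" for z by (auto simp: is_arg_min_def not_less)
  have "?f (X \<xi>) \<le> ereal (\<theta> x - blinfun_apply \<xi> x)" using le[of x] Theta_real[OF x(1)] by simp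
  then show dom: "X \<xi> \<in> dom_fun \<Theta>"
    by (cases "X \<xi> \<in> dom_fun \<Theta>") (simp_all add: Theta_outside)
  show "\<theta> (X \<xi>) - blinfun_apply \<xi> (X \<xi>) \<le> \<theta> z - blinfun_apply \<xi> z" if "z \<in> dom_fun \<Theta>"
    using le[of z] Theta_real[OF dom] Theta_real[OF that] by simp
qed

definition D :: "('a \<Rightarrow>\<^sub>L real) \<Rightarrow> 'a \<Rightarrow> real" where
  "D \<xi> z = \<theta> z - \<theta> (X \<xi>) - blinfun_apply \<xi> (z - X \<xi>)"

lemma bregman_X: "z \<in> dom_fun \<Theta> \<Longrightarrow> bregman \<Theta> \<xi> z (X \<xi>) = ereal (D \<xi> z)"
  using X_dom by (simp add: bregman_def D_def Theta_real)

text \<open>Minimality of \<open>X \<xi>\<close> makes \<open>\<xi>\<close> a subgradient there, so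
  the coercivity hypothesis \<open>Theta_bregman\<close> applies.\<close>

lemma D_ge:
  assumes "z \<in> dom_fun \<Theta>"
  shows "c0 * norm (z - X \<xi>) powr p \<le> D \<xi> z"
proof -
  have "\<xi> \<in> subdifferential \<Theta> (X \<xi>)"
    unfolding subdifferential_def
  proof (intro CollectI allI)
    fix w
    show "0 \<le> \<Theta> w - \<Theta> (X \<xi>) - ereal (blinfun_apply \<xi> (w - X \<xi>))"
      using X_min[of w \<xi>] Theta_outside[of w] Theta_real[OF X_dom, of \<xi>]
      by (cases "w \<in> dom_fun \<Theta>") (auto simp: Theta_real blinfun.bilinear_simps)
  qed
  then have "ereal (c0 * norm (z - X \<xi>) powr p) \<le> bregman \<Theta> \<xi> z (X \<xi>)"
    using X_dom by (intro Theta_bregman) (auto simp: dom_subdifferential_def)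
  then show ?thesis using bregman_X[OF assms] by simp
qed

lemma D_nonneg: "z \<in> dom_fun \<Theta> \<Longrightarrow> 0 \<le> D \<xi> z"
  using D_ge[of z \<xi>] c0_pos by (meson mult_nonneg_nonneg less_imp_le order_trans powr_ge_zero)

lemma norm_le_of_D_le:
  assumes "z \<in> dom_fun \<Theta>" "D \<xi> z \<le> c0 * t powr p" "t \<ge> 0"
  shows "norm (z - X \<xi>) \<le> t"
proof (rule ccontr)
  assume "\<not> norm (z - X \<xi>) \<le> t"
  then have "t powr p < norm (z - X \<xi>) powr p"
    using assms(3) p_ge by (intro powr_less_mono2) auto
  then have "c0 * t powr p < c0 * norm (z - X \<xi>) powr p"
    using c0_pos by simp
  then show False using D_ge[OF assms(1), of \<xi>] assms(2) by linarith
qed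

text \<open>The three-point identity of Bregman distances; changes of the dual variable are
  evaluated through it.\<close>

lemma D_change:
  "D \<xi>' z = D \<xi> z + D \<xi>' (X \<xi>) + blinfun_apply (\<xi>' - \<xi>) (X \<xi> - z)"
  by (simp add: D_def blinfun.bilinear_simps algebra_simps)

lemma D_X_X: "D \<xi>' (X \<xi>) + D \<xi> (X \<xi>') = blinfun_apply (\<xi>' - \<xi>) (X \<xi>' - X \<xi>)"
  by (simp add: D_def blinfun.bilinear_simps algebra_simps)

text \<open>The symmetric identity \<open>D_X_X\<close> and coercivity in both directions give
  \<open>2 * c0 * t powr p \<le> norm (\<xi>' - \<xi>) * t\<close> for the distance \<open>t\<close>
  of the minimisers: the minimiser map is Hoelder continuous with exponent
  \<open>1 / (p - 1)\<close>.\<close>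

lemma X_diff_le:
  "norm (X \<xi>' - X \<xi>) \<le> (norm (\<xi>' - \<xi>) / (2 * c0)) powr (1 / (p - 1))"
proof (cases "X \<xi>' = X \<xi>")
  case False
  define t where "t = norm (X \<xi>' - X \<xi>)"
  have t: "t > 0" using False by (simp add: t_def)
  have e: "t * t powr (p - 1) = t powr p" using powr_mult_base[of t "p - 1"] t by simp
  have "c0 * t powr p + c0 * t powr p \<le> D \<xi>' (X \<xi>) + D \<xi> (X \<xi>')"
    using D_ge[OF X_dom, of \<xi> \<xi>'] D_ge[OF X_dom, of \<xi>' \<xi>] by (simp add: t_def norm_minus_commute)
  also have "\<dots> \<le> norm (\<xi>' - \<xi>) * t"
    unfolding D_X_X t_def using norm_blinfun[of "\<xi>' - \<xi>" "X \<xi>' - X \<xi>"] by simp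
  finally have "t * (2 * c0 * t powr (p - 1)) \<le> t * norm (\<xi>' - \<xi>)"
    by (simp add: algebra_simps flip: e)
  then have "2 * c0 * t powr (p - 1) \<le> norm (\<xi>' - \<xi>)"
    using t by (simp only: mult_le_cancel_left_pos)
  then have "t powr (p - 1) \<le> norm (\<xi>' - \<xi>) / (2 * c0)"
    using c0_pos by (simp add: field_simps)
  then have "(t powr (p - 1)) powr (1 / (p - 1)) \<le> (norm (\<xi>' - \<xi>) / (2 * c0)) powr (1 / (p - 1))"
    using p_ge by (intro powr_mono2) auto
  then show ?thesis using t p_ge by (simp add: powr_powr t_def)
qed simp

lemma X_tendsto:
  assumes "(\<xi>' \<longlongrightarrow> \<xi>) f"
  shows "((\<lambda>k. X (\<xi>' k)) \<longlongrightarrow> X \<xi>) f"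
proof -
  have "((\<lambda>k. norm (\<xi>' k - \<xi>)) \<longlongrightarrow> 0) f"
    using assms by (simp add: tendsto_norm_zero_iff LIM_zero_iff)
  then have "((\<lambda>k. norm (\<xi>' k - \<xi>) / (2 * c0)) \<longlongrightarrow> 0) f"
    by (rule tendsto_divide_zero)
  then have "((\<lambda>k. (norm (\<xi>' k - \<xi>) / (2 * c0)) powr (1 / (p - 1))) \<longlongrightarrow> 0) f"
    using p_ge c0_pos by (intro tendsto_zero_powrI[where b = "1 / (p - 1)"]) auto
  then have "((\<lambda>k. norm (X (\<xi>' k) - X \<xi>)) \<longlongrightarrow> 0) f"
    by (rule tendsto_sandwich[OF _ _ tendsto_const, rotated 2]) (auto intro!: X_diff_le always_eventually)
  then show ?thesis by (simp add: tendsto_norm_zero_iff LIM_zero_iff)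
qed

text \<open>\<open>\<theta>\<close> is only lower semicontinuous, so convergence of its values along
  \<open>X (\<xi>' k)\<close> cannot be quoted. In the three-point identity they do not occur
  separately: its middle term is nonnegative and, by the symmetric identity, bounded by a pairing
  that tends to 0.\<close>

lemma D_tendsto:
  assumes "(\<xi>' \<longlongrightarrow> \<xi>) f" "z \<in> dom_fun \<Theta>"
  shows "((\<lambda>k. D (\<xi>' k) z) \<longlongrightarrow> D \<xi> z) f"
proof -
  have d: "((\<lambda>k. \<xi>' k - \<xi>) \<longlongrightarrow> 0) f" using assms(1) by (simp add: LIM_zero_iff)
  have "((\<lambda>k. blinfun_apply (\<xi>' k - \<xi>) (X (\<xi>' k) - X \<xi>)) \<longlongrightarrow> blinfun_apply 0 (X \<xi> - X \<xi>)) f"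
    by (intro tendsto_intros d X_tendsto assms(1))
  then have lim: "((\<lambda>k. blinfun_apply (\<xi>' k - \<xi>) (X (\<xi>' k) - X \<xi>)) \<longlongrightarrow> 0) f" by simp
  have low: "eventually (\<lambda>k. 0 \<le> D (\<xi>' k) (X \<xi>)) f"
    using D_nonneg[OF X_dom] by simp
  have up: "D \<xi>'' (X \<xi>) \<le> blinfun_apply (\<xi>'' - \<xi>) (X \<xi>'' - X \<xi>)" for \<xi>''
    using D_X_X[of \<xi>'' \<xi>] D_nonneg[OF X_dom, of \<xi> \<xi>''] by linarith
  have "((\<lambda>k. D (\<xi>' k) (X \<xi>)) \<longlongrightarrow> 0) f"
    by (rule tendsto_sandwich[OF low always_eventually tendsto_const lim]) (intro allI up)
  moreover have "((\<lambda>k. blinfun_apply (\<xi>' k - \<xi>) (X \<xi> - z)) \<longlongrightarrow> blinfun_apply 0 (X \<xi> - z)) f"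
    by (intro tendsto_intros d)
  ultimately have "((\<lambda>k. D \<xi> z + D (\<xi>' k) (X \<xi>) + blinfun_apply (\<xi>' k - \<xi>) (X \<xi> - z)) \<longlongrightarrow> D \<xi> z + 0 + 0) f"
    by (intro tendsto_intros) auto
  then show ?thesis unfolding D_change[of "\<xi>' _" z \<xi>] by simp
qed

lemma D_le_limit:
  assumes "u \<longlonglongrightarrow> x" "\<And>n. u n \<in> dom_fun \<Theta>" "\<And>n. D \<xi> (u n) \<le> e"
  shows "x \<in> dom_fun \<Theta>" "D \<xi> x \<le> e"
proof -
  let ?b = "\<lambda>z. e + \<theta> (X \<xi>) + blinfun_apply \<xi> (z - X \<xi>)"
  have "\<Theta> x \<le> ereal (?b x)"
  proof (rule lower_semicontinuous_limit[OF Theta_lsc assms(1)])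
    show "\<Theta> (u n) \<le> ereal (?b (u n))" for n
      using assms(3)[of n] Theta_real[OF assms(2)] by (simp add: D_def)
    show "(\<lambda>n. ?b (u n)) \<longlonglongrightarrow> ?b x" by (intro tendsto_intros assms(1))
  qed
  then show "x \<in> dom_fun \<Theta>" "D \<xi> x \<le> e"
    using dom_funI[of x] Theta_real[of x] by (auto simp: D_def)
qed

text \<open>In the symmetric sum \<open>D \<xi>' (X \<xi>) + D \<xi> (X \<xi>') \<le> s * t\<close>
  the second term is at least \<open>c0 * t powr p\<close>; Young's inequality lets it absorb
  exactly that part of \<open>s * t\<close>. The remainder is the source of the last term in the
  parameter condition.\<close>

lemma D_X_le:
  assumes "norm (\<xi>' - \<xi>) \<le> s"
  shows "D \<xi>' (X \<xi>) \<le> (p - 1) / p * s * (s / (2 * c0)) powr (1 / (p - 1))"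
proof -
  define t where "t = norm (X \<xi>' - X \<xi>)"
  define q where "q = p / (p - 1)"
  \<comment> \<open>Weight in Young's inequality, chosen so that
    \<open>(a * t) powr p / p = c0 * t powr p\<close>.\<close>
  define a where "a = (p * c0) powr (1 / p)"
  have s: "s \<ge> 0" using assms norm_ge_zero order_trans by blast
  have q: "q > 1" "1 / p + 1 / q = 1" "1 / q = (p - 1) / p" using p_ge by (auto simp: q_def field_simps)
  have a: "a > 0" "a powr p = p * c0" using p_ge c0_pos by (auto simp: a_def powr_powr)
  have y1: "(a * t) * (s / a) \<le> (a * t) powr p / p + (s / a) powr q / q"
    using p_ge q a s by (intro Youngs_inequality) (auto simp: t_def)
  have y2: "(a * t) powr p / p = c0 * t powr p"
    using a p_ge by (simp add: powr_mult t_def)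
  have y3: "(s / a) powr q = s * (s / (p * c0)) powr (1 / (p - 1))"
  proof (cases "s = 0")
    case False
    then have "(s / a) powr q = (s / a) powr (p * (1 / (p - 1)))" by (simp add: q_def)
    also have "\<dots> = ((s / a) powr p) powr (1 / (p - 1))" by (rule powr_powr[symmetric])
    also have "(s / a) powr p = s powr p / (p * c0)" using s a by (simp add: powr_divide)
    also have "s powr p = s powr (p - 1) * s"
      using powr_mult_base[of s "p - 1"] s by (simp add: mult.commute)
    also have "(s powr (p - 1) * s / (p * c0)) powr (1 / (p - 1)) =
        (s powr (p - 1)) powr (1 / (p - 1)) * (s / (p * c0)) powr (1 / (p - 1))"
      using s p_ge c0_pos by (subst powr_mult[symmetric]) auto
    also have "(s powr (p - 1)) powr (1 / (p - 1)) = s"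
      using s p_ge by (simp add: powr_powr)
    finally show ?thesis .
  qed simp
  have qd: "w / q = (p - 1) / p * w" for w
    unfolding q(3)[symmetric] by simp
  have "s * t = (a * t) * (s / a)" using a(1) by simp
  also note y1
  finally have "s * t \<le> c0 * t powr p + (p - 1) / p * (s * (s / (p * c0)) powr (1 / (p - 1)))"
    unfolding y2 y3 qd .
  \<comment> \<open>Young's inequality produces \<open>p * c0\<close> in the denominator;
    \<open>p \<ge> 2\<close> weakens this to the \<open>2 * c0\<close> of
    \<open>X_diff_le\<close>.\<close>
  moreover have "(s / (p * c0)) powr (1 / (p - 1)) \<le> (s / (2 * c0)) powr (1 / (p - 1))"
    using s p_ge c0_pos by (intro powr_mono2 divide_left_mono) auto
  then have "(p - 1) / p * (s * (s / (p * c0)) powr (1 / (p - 1)))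
      \<le> (p - 1) / p * (s * (s / (2 * c0)) powr (1 / (p - 1)))"
    using p_ge s by (intro mult_left_mono) auto
  moreover have "D \<xi>' (X \<xi>) + D \<xi> (X \<xi>') \<le> s * t"
  proof -
    have "blinfun_apply (\<xi>' - \<xi>) (X \<xi>' - X \<xi>) \<le> norm (\<xi>' - \<xi>) * t"
      unfolding t_def using norm_blinfun[of "\<xi>' - \<xi>" "X \<xi>' - X \<xi>"] by simp
    also have "\<dots> \<le> s * t" using assms by (intro mult_right_mono) (auto simp: t_def)
    finally show ?thesis unfolding D_X_X .
  qed
  ultimately show ?thesis
    using D_ge[OF X_dom, of \<xi>' \<xi>] by (simp add: t_def mult.assoc)
qed

end

section \<open>Descent along the iteration\<close>

text \<open>The first index at which \<open>V\<close> falls below all of its values up to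
  \<open>m\<close> is a record and lies beyond \<open>m\<close>. It exists when these values are
  positive; a zero among them would persist up to \<open>m\<close>, and then \<open>m\<close> itself
  is a record.\<close>

lemma infinitely_many_record_minima:
  fixes V :: "nat \<Rightarrow> real"
  assumes lim: "V \<longlonglongrightarrow> 0" and nonneg: "\<And>n. 0 \<le> V n" and absorb: "\<And>n. V n = 0 \<Longrightarrow> V (Suc n) = 0"
  shows "\<exists>l\<ge>m. \<forall>n\<le>l. V l \<le> V n"
proof (cases "V m = 0")
  case True
  then show ?thesis using nonneg by auto
next
  case False
  have "V m = 0" if "V n = 0" "n \<le> m" for n
    using that(2,1) by (induction rule: dec_induct) (auto intro: absorb)
  then have pos: "V n > 0" if "n \<le> m" for n
    using that False nonneg[of n] by (metis less_eq_real_def)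
  define \<epsilon> where "\<epsilon> = Min (V ` {..m})"
  have eps: "\<epsilon> > 0" "\<And>n. n \<le> m \<Longrightarrow> \<epsilon> \<le> V n"
    using pos by (auto simp: \<epsilon>_def)
  have "\<exists>n. V n < \<epsilon>"
    using eventually_happens'[OF _ order_tendstoD(2)[OF lim eps(1)]] by auto
  then have l: "V (LEAST n. V n < \<epsilon>) < \<epsilon>" by (rule LeastI_ex)
  have low: "V n \<ge> \<epsilon>" if "n < (LEAST n. V n < \<epsilon>)" for n
    using not_less_Least[OF that] by simp
  show ?thesis
  proof (intro exI[of _ "LEAST n. V n < \<epsilon>"] conjI allI impI)
    show "m \<le> (LEAST n. V n < \<epsilon>)"
      using l eps(2) by (meson leD nat_le_linear)
    fix n assume "n \<le> (LEAST n. V n < \<epsilon>)"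
    then show "V (LEAST n. V n < \<epsilon>) \<le> V n"
      using l low[of n] by (cases "n = (LEAST n. V n < \<epsilon>)") auto
  qed
qed

locale lk_system = tilted_convex \<Theta> p c0
  for \<Theta> :: "'a::banach \<Rightarrow> ereal" and p c0 :: real +
  fixes N :: nat
    and Y :: "nat \<Rightarrow> 'b::banach set"
    and DF :: "nat \<Rightarrow> 'a set"
    and F :: "nat \<Rightarrow> 'a \<Rightarrow> 'b"
    and F' :: "nat \<Rightarrow> 'a \<Rightarrow> ('a \<Rightarrow>\<^sub>L 'b)"
    and y :: "nat \<Rightarrow> 'b"
    and \<xi>0 :: "'a \<Rightarrow>\<^sub>L real" and x0 xdag :: 'a
    and r \<rho> \<eta> \<tau> \<mu>0 :: real
  assumes Y_banach: "\<And>i. i < N \<Longrightarrow> subspace (Y i) \<and> closed (Y i)"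
    and Y_smooth: "\<And>i. i < N \<Longrightarrow> uniformly_smooth_on (Y i)"
    and F_maps: "\<And>i x. i < N \<Longrightarrow> x \<in> DF i \<Longrightarrow> F i x \<in> Y i"
    and y_in: "\<And>i. i < N \<Longrightarrow> y i \<in> Y i"
    and x0_def: "x0 = argmin_tilted \<Theta> \<xi>0"
    and A: "assumption_A N Y DF F F' y \<Theta> x0 \<rho> \<eta>"
    and xdag: "is_arg_min (\<lambda>x. bregman \<Theta> \<xi>0 x x0)
                 (\<lambda>x. x \<in> dom_fun \<Theta> \<inter> (\<Inter>i<N. DF i) \<and> solves N F y x) xdag"
    and xdag_close: "bregman \<Theta> \<xi>0 xdag x0 \<le> ereal (c0 * \<rho> powr p)"
    and r_gt: "r > 1"
    and tau_gt: "\<tau> > 1"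
    and mu0_pos: "\<mu>0 > 0"
    and params: "1 - \<eta> - (1 + \<eta>) / \<tau> - (p - 1) / p * (\<mu>0 / (2 * c0)) powr (1 / (p - 1)) > 0"
begin

section \<open>Constants and consequences of the assumptions on the system\<close>

abbreviation B :: "'a set" where "B \<equiv> cball x0 (2 * \<rho>)"

text \<open>By \<open>upd_X\<close> a substep moves the primal iterate by at most \<open>L\<close>
  times the active residual.\<close>

definition L :: real where "L = (\<mu>0 / (2 * c0)) powr (1 / (p - 1))"

definition \<kappa> :: real where "\<kappa> = 1 - \<eta> - (1 + \<eta>) / \<tau> - (p - 1) / p * L"

lemma L_nonneg: "L \<ge> 0" by (simp add: L_def)

lemma kappa_pos: "\<kappa> > 0" using params by (simp add: \<kappa>_def L_def)

lemma rho_pos: "\<rho> > 0" and eta: "0 \<le> \<eta>" "\<eta> < 1"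
  and ball_dom: "i < N \<Longrightarrow> x \<in> B \<Longrightarrow> x \<in> DF i"
  and F_deriv: "i < N \<Longrightarrow> x \<in> B \<Longrightarrow> (F i has_derivative blinfun_apply (F' i x)) (at x within B)"
  and F'_cont: "i < N \<Longrightarrow> continuous_on B (F' i)"
  and F'_norm: "i < N \<Longrightarrow> x \<in> B \<Longrightarrow> norm (F' i x) \<le> 1"
  and tangential_cone: "i < N \<Longrightarrow> x \<in> B \<Longrightarrow> x' \<in> B \<Longrightarrow>
         norm (F i x - F i x' - blinfun_apply (F' i x') (x - x')) \<le> \<eta> * norm (F i x - F i x')"
  using A unfolding assumption_A_def by (blast+)

lemma F_in_Y: "i < N \<Longrightarrow> x \<in> B \<Longrightarrow> F i x \<in> Y i"
  using F_maps ball_dom by blast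

lemma F_cont: "i < N \<Longrightarrow> continuous_on B (F i)"
  using F_deriv by (intro has_derivative_continuous_on) auto

text \<open>Also at boundary points of the ball every direction is a multiple of a difference of two
  directions pointing into the ball.\<close>

lemma F'_in_Y:
  assumes i: "i < N" and x: "x \<in> B"
  shows "blinfun_apply (F' i x) h \<in> Y i"
proof -
  note sub = conjunct1[OF Y_banach[OF i]]
  have inward: "blinfun_apply (F' i x) h \<in> Y i" if h: "x + h \<in> B" for h
  proof -
    have "blinfun_apply (F' i x) h \<in> closure (Y i)"
      unfolding closure_approachable
    proof (intro allI impI)
      fix e :: real assume e: "e > 0"
      define e' where "e' = e / 2 / (norm h + 1)"
      have e': "e' > 0" "e' * norm h < e"
      proof -
        have n: "norm h + 1 > 0" by (simp add: add_nonneg_pos)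
        then show "e' > 0" using e unfolding e'_def by (intro divide_pos_pos) auto
        moreover have "e' * (norm h + 1) = e / 2" unfolding e'_def using n
          by (intro nonzero_eq_divide_eq[THEN iffD1]) auto
        ultimately show "e' * norm h < e" using e by (simp add: algebra_simps)
      qed
      obtain d where d: "d > 0" "\<And>z. z \<in> B \<Longrightarrow> norm (z - x) < d \<Longrightarrow>
          norm (F i z - F i x - blinfun_apply (F' i x) (z - x)) \<le> e' * norm (z - x)"
        using F_deriv[OF i x] e'(1) unfolding has_derivative_within_alt by blast
      define t where "t = min 1 (d / 2 / (norm h + 1))"
      have n: "norm h + 1 > 0" by (simp add: add_nonneg_pos)
      have t: "0 < t" "t \<le> 1" "t * norm h < d"
      proof -
        show "0 < t" "t \<le> 1" using d n by (auto simp: t_def)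
        have "t * (norm h + 1) \<le> d / 2 / (norm h + 1) * (norm h + 1)"
          using n by (intro mult_right_mono) (auto simp: t_def)
        also have "\<dots> = d / 2" using n by (intro nonzero_eq_divide_eq[THEN iffD1]) auto
        finally show "t * norm h < d" using d \<open>0 < t\<close> by (simp add: algebra_simps)
      qed
      have "x + t *\<^sub>R h = (1 - t) *\<^sub>R x + t *\<^sub>R (x + h)" by (simp add: algebra_simps)
      then have z: "x + t *\<^sub>R h \<in> B"
        using convexD_alt[OF convex_cball x h, of t] t by simp
      have "norm (F i (x + t *\<^sub>R h) - F i x - t *\<^sub>R blinfun_apply (F' i x) h) \<le> e' * (t * norm h)"
        using d(2)[OF z] t by (simp add: blinfun.scaleR_right)
      moreover have "F i (x + t *\<^sub>R h) - F i x - t *\<^sub>R blinfun_apply (F' i x) h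
          = t *\<^sub>R ((1 / t) *\<^sub>R (F i (x + t *\<^sub>R h) - F i x) - blinfun_apply (F' i x) h)"
        using t by (simp add: scaleR_diff_right)
      ultimately have "t * norm ((1 / t) *\<^sub>R (F i (x + t *\<^sub>R h) - F i x) - blinfun_apply (F' i x) h)
          \<le> t * (e' * norm h)"
        using t by (simp add: mult_ac)
      then have "dist ((1 / t) *\<^sub>R (F i (x + t *\<^sub>R h) - F i x)) (blinfun_apply (F' i x) h) < e"
        using t(1) e'(2) by (simp add: dist_norm)
      moreover have "(1 / t) *\<^sub>R (F i (x + t *\<^sub>R h) - F i x) \<in> Y i"
        using F_in_Y[OF i] x z sub by (intro subspace_scale subspace_diff)
      ultimately show "\<exists>v\<in>Y i. dist v (blinfun_apply (F' i x) h) < e" by blast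
    qed
    then show ?thesis using Y_banach[OF i] by simp
  qed
  have small: "blinfun_apply (F' i x) h \<in> Y i" if "norm h \<le> 2 * \<rho>" for h
  proof -
    have "blinfun_apply (F' i x) ((x0 - x) + h) - blinfun_apply (F' i x) (x0 - x) \<in> Y i"
      using that rho_pos by (intro subspace_diff[OF sub] inward) (auto simp: dist_norm)
    then show ?thesis by (simp add: blinfun.add_right)
  qed
  show ?thesis
  proof (cases "h = 0")
    case True
    then show ?thesis using subspace_0[OF sub] by (simp add: blinfun.zero_right)
  next
    case False
    have "(norm h / \<rho>) *\<^sub>R blinfun_apply (F' i x) ((\<rho> / norm h) *\<^sub>R h) \<in> Y i"
      using False rho_pos by (intro subspace_scale[OF sub] small) auto
    then show ?thesis using False rho_pos by (simp add: blinfun.scaleR_right)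
  qed
qed

text \<open>\<open>\<eta> < 1\<close> lets the cone error be absorbed on the left; the derivative
  bound 1 then leaves the Lipschitz constant \<open>1 / (1 - \<eta>)\<close>.\<close>

lemma F_lipschitz:
  assumes "i < N" "x \<in> B" "x' \<in> B"
  shows "norm (F i x - F i x') \<le> norm (x - x') / (1 - \<eta>)"
proof -
  have "norm (F i x - F i x') \<le> norm (F i x - F i x' - blinfun_apply (F' i x') (x - x'))
      + norm (blinfun_apply (F' i x') (x - x'))"
    using norm_triangle_ineq[of "F i x - F i x' - blinfun_apply (F' i x') (x - x')"
      "blinfun_apply (F' i x') (x - x')"] by simp
  also have "norm (blinfun_apply (F' i x') (x - x')) \<le> 1 * norm (x - x')"
    using norm_blinfun[of "F' i x'" "x - x'"] F'_norm[OF assms(1,3)]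
    by (meson mult_right_mono norm_ge_zero order_trans)
  finally have "(1 - \<eta>) * norm (F i x - F i x') \<le> norm (x - x')"
    using tangential_cone[OF assms] by (simp add: algebra_simps)
  then show ?thesis using eta by (simp add: field_simps)
qed

text \<open>Reverse use of the cone condition by the triangle inequality. Applied to two solutions
  it puts their difference into the kernel of the derivative.\<close>

lemma F'_diff_le:
  assumes "i < N" "x \<in> B" "x' \<in> B"
  shows "norm (blinfun_apply (F' i x') (x - x')) \<le> (1 + \<eta>) * norm (F i x - F i x')"
  using tangential_cone[OF assms]
    norm_triangle_ineq4[of "F i x - F i x'" "F i x - F i x' - blinfun_apply (F' i x') (x - x')"]
  by (simp add: algebra_simps)

definition sol :: "'a \<Rightarrow> bool" where
  "sol z \<longleftrightarrow> z \<in> B \<and> z \<in> dom_fun \<Theta> \<and> solves N F y z"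

lemma sol_F: "sol z \<Longrightarrow> i < N \<Longrightarrow> F i z = y i"
  by (simp add: sol_def solves_def)

lemma xdag_dom: "xdag \<in> dom_fun \<Theta>"
  using xdag by (simp add: is_arg_min_def)

lemma D_xdag_le: "D \<xi>0 xdag \<le> c0 * \<rho> powr p"
  using xdag_close bregman_X[OF xdag_dom, of \<xi>0] by (simp add: x0_def)

lemma xdag_near: "norm (xdag - x0) \<le> \<rho>"
  using norm_le_of_D_le[OF xdag_dom D_xdag_le] rho_pos by (simp add: x0_def)

lemma sol_xdag: "sol xdag"
  using xdag xdag_near rho_pos by (simp add: sol_def is_arg_min_def dist_norm norm_minus_commute)

lemma D_xdag_minimal:
  assumes "sol z"
  shows "D \<xi>0 xdag \<le> D \<xi>0 z"
proof -
  have z: "z \<in> dom_fun \<Theta>" "z \<in> (\<Inter>i<N. DF i)" "solves N F y z"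
    using assms ball_dom by (auto simp: sol_def)
  then have "\<not> bregman \<Theta> \<xi>0 z x0 < bregman \<Theta> \<xi>0 xdag x0"
    using xdag by (auto simp: is_arg_min_def)
  then show ?thesis using bregman_X[of _ \<xi>0] z(1) xdag_dom by (simp add: x0_def not_less)
qed

text \<open>Explains the radius \<open>2 * \<rho>\<close>: under this bound \<open>X \<xi>\<close>
  is within \<open>\<rho>\<close> of \<open>xdag\<close>, which is within \<open>\<rho>\<close> of
  \<open>x0\<close>. As \<open>D \<xi> xdag\<close> does not increase, the bound is inherited along
  the iteration.\<close>

lemma X_in_B:
  assumes "D \<xi> xdag \<le> c0 * \<rho> powr p"
  shows "X \<xi> \<in> B"
proof -
  have "norm (x0 - X \<xi>) \<le> norm (xdag - X \<xi>) + norm (xdag - x0)"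
    using norm_triangle_ineq4[of "xdag - X \<xi>" "xdag - x0"] by simp
  then show ?thesis
    using norm_le_of_D_le[OF xdag_dom assms] rho_pos xdag_near by (simp add: dist_norm)
qed

section \<open>One substep of the iteration\<close>

definition noisy :: "real \<Rightarrow> (nat \<Rightarrow> 'b) \<Rightarrow> bool" where
  "noisy \<delta> yd \<longleftrightarrow> \<delta> \<ge> 0 \<and> (\<forall>i<N. yd i \<in> Y i \<and> norm (yd i - y i) \<le> \<delta>)"

text \<open>\<open>noisy\<close> admits \<open>\<delta> = 0\<close>, so facts proved from
  \<open>noisy\<close> alone hold for the exact iteration as well.\<close>

lemma noisy_exact: "noisy 0 y"
  using y_in by (simp add: noisy_def)

text \<open>The primal iterate is always \<open>X \<xi>\<close>, so the dual variable alone serves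
  as state.\<close>

definition upd :: "real \<Rightarrow> (nat \<Rightarrow> 'b) \<Rightarrow> nat \<Rightarrow> ('a \<Rightarrow>\<^sub>L real) \<Rightarrow> ('a \<Rightarrow>\<^sub>L real)" where
  "upd \<delta> yd i \<xi> = \<xi> - adjoint_on (F' i (X \<xi>)) (step_functional (Y i) p r \<tau> \<mu>0 \<delta> (F i (X \<xi>) - yd i))"

definition res :: "real \<Rightarrow> (nat \<Rightarrow> 'b) \<Rightarrow> nat \<Rightarrow> ('a \<Rightarrow>\<^sub>L real) \<Rightarrow> real" where
  "res \<delta> yd i \<xi> = active_norm (\<tau> * \<delta>) (F i (X \<xi>) - yd i)"

lemma res_nonneg: "0 \<le> res \<delta> yd i \<xi>"
  by (simp add: res_def active_norm_def)

lemma res_exact: "res 0 y i \<xi> = norm (F i (X \<xi>) - y i)"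
  by (simp add: res_def active_norm_def)

lemma p_gt: "p > 1" using p_ge by simp

context
  fixes \<delta> yd i \<xi>
  assumes noisy: "noisy \<delta> yd" and i: "i < N" and XB: "X \<xi> \<in> B"
begin

private lemma sub: "subspace (Y i)" and sm: "uniformly_smooth_on (Y i)"
  using Y_banach[OF i] Y_smooth[OF i] by auto

private lemma residual_in_Y: "F i (X \<xi>) - yd i \<in> Y i"
  using F_in_Y[OF i XB] noisy i subspace_diff[OF sub] by (simp add: noisy_def)

lemma lk_step_eq:
  "lk_step Y F F' \<Theta> p r \<tau> \<mu>0 \<delta> yd i (\<xi>, X \<xi>) = (upd \<delta> yd i \<xi>, X (upd \<delta> yd i \<xi>))"
  using lk_update_eq[OF sub sm r_gt p_gt mu0_pos residual_in_Y F'_in_Y[OF i XB]]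
  by (simp add: lk_step_def Let_def upd_def)

lemma upd_apply:
  "blinfun_apply (upd \<delta> yd i \<xi>) h = blinfun_apply \<xi> h
     - step_functional (Y i) p r \<tau> \<mu>0 \<delta> (F i (X \<xi>) - yd i) (blinfun_apply (F' i (X \<xi>)) h)"
  using adjoint_on_apply[OF sub step_functional_dual[OF sub sm r_gt p_gt mu0_pos residual_in_Y]
      F'_in_Y[OF i XB]]
  by (simp add: upd_def blinfun.diff_left)

lemma upd_apply_diff:
  "\<bar>blinfun_apply (upd \<delta> yd i \<xi> - \<xi>) h\<bar>
     \<le> \<mu>0 * res \<delta> yd i \<xi> powr (p - 1) * norm (blinfun_apply (F' i (X \<xi>)) h)"
  using step_functional_bound[OF sub sm r_gt p_gt mu0_pos residual_in_Y F'_in_Y[OF i XB]]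
  by (simp add: blinfun.diff_left upd_apply res_def)

lemma upd_norm: "norm (upd \<delta> yd i \<xi> - \<xi>) \<le> \<mu>0 * res \<delta> yd i \<xi> powr (p - 1)"
proof (rule norm_blinfun_bound)
  fix h
  have "norm (blinfun_apply (F' i (X \<xi>)) h) \<le> 1 * norm h"
    using norm_blinfun[of "F' i (X \<xi>)" h] F'_norm[OF i XB]
    by (meson mult_right_mono norm_ge_zero order_trans)
  then have "\<mu>0 * res \<delta> yd i \<xi> powr (p - 1) * norm (blinfun_apply (F' i (X \<xi>)) h)
      \<le> \<mu>0 * res \<delta> yd i \<xi> powr (p - 1) * norm h"
    using mu0_pos by (intro mult_left_mono) auto
  then show "norm (blinfun_apply (upd \<delta> yd i \<xi> - \<xi>) h) \<le> \<mu>0 * res \<delta> yd i \<xi> powr (p - 1) * norm h"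
    using upd_apply_diff[of h] by simp
qed (use mu0_pos in auto)

private lemma root_res: "(\<mu>0 * res \<delta> yd i \<xi> powr (p - 1) / (2 * c0)) powr (1 / (p - 1)) = L * res \<delta> yd i \<xi>"
proof -
  have "(\<mu>0 * res \<delta> yd i \<xi> powr (p - 1) / (2 * c0)) powr (1 / (p - 1))
      = (\<mu>0 / (2 * c0) * res \<delta> yd i \<xi> powr (p - 1)) powr (1 / (p - 1))" by simp
  also have "\<dots> = L * (res \<delta> yd i \<xi> powr (p - 1)) powr (1 / (p - 1))"
    unfolding L_def by (rule powr_mult)
  also have "\<dots> = L * res \<delta> yd i \<xi>"
    using p_gt res_nonneg[of \<delta> yd i \<xi>] by (simp add: powr_powr)
  finally show ?thesis .
qed

lemma upd_X: "norm (X (upd \<delta> yd i \<xi>) - X \<xi>) \<le> L * res \<delta> yd i \<xi>"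
proof -
  have "norm (X (upd \<delta> yd i \<xi>) - X \<xi>) \<le> (norm (upd \<delta> yd i \<xi> - \<xi>) / (2 * c0)) powr (1 / (p - 1))"
    by (rule X_diff_le)
  also have "\<dots> \<le> (\<mu>0 * res \<delta> yd i \<xi> powr (p - 1) / (2 * c0)) powr (1 / (p - 1))"
    using upd_norm p_gt c0_pos by (intro powr_mono2 divide_right_mono) auto
  finally show ?thesis unfolding root_res .
qed

text \<open>In the three-point identity the remainder is bounded by \<open>D_X_le\<close>, and the
  pairing equals \<open>\<psi> w - \<psi> v\<close>, where \<open>\<psi> v\<close> is the gain
  \<open>\<mu>0 * e powr p\<close>. Cone error, noise and remainder are the three terms subtracted
  in \<open>\<kappa>\<close>.\<close>

lemma upd_D:
  assumes z: "sol z"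
  shows "D (upd \<delta> yd i \<xi>) z + \<kappa> * \<mu>0 * res \<delta> yd i \<xi> powr p \<le> D \<xi> z"
proof -
  define v where "v = F i (X \<xi>) - yd i"
  define e where "e = res \<delta> yd i \<xi>"
  define \<psi> where "\<psi> = step_functional (Y i) p r \<tau> \<mu>0 \<delta> v"
  define w where "w = v - blinfun_apply (F' i (X \<xi>)) (X \<xi> - z)"
  have v: "v \<in> Y i" using residual_in_Y by (simp add: v_def)
  have zB: "z \<in> B" and Fz: "F i z = y i" using z i by (auto simp: sol_def solves_def)
  have yd: "norm (yd i - y i) \<le> \<delta>" "\<delta> \<ge> 0" using noisy i by (auto simp: noisy_def)
  have e: "e \<ge> 0" "e powr (p - 1) * e = e powr p"
    using res_nonneg powr_mult_base[of e "p - 1"] by (auto simp: e_def mult.commute)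
  have "D (upd \<delta> yd i \<xi>) (X \<xi>)
      \<le> (p - 1) / p * (\<mu>0 * e powr (p - 1)) * (\<mu>0 * e powr (p - 1) / (2 * c0)) powr (1 / (p - 1))"
    using upd_norm by (intro D_X_le) (simp add: e_def)
  also have "\<dots> = (p - 1) / p * (\<mu>0 * e powr (p - 1)) * (L * e)"
    by (simp only: root_res e_def)
  also have "\<dots> = (p - 1) / p * L * \<mu>0 * (e powr (p - 1) * e)"
    by (simp only: mult_ac)
  finally have D1: "D (upd \<delta> yd i \<xi>) (X \<xi>) \<le> (p - 1) / p * L * \<mu>0 * e powr p"
    unfolding e(2) .
  have dual: "\<psi> \<in> dual_on (Y i)"
    unfolding \<psi>_def by (rule step_functional_dual[OF sub sm r_gt p_gt mu0_pos v])
  have "w \<in> Y i" unfolding w_def using v F'_in_Y[OF i XB] subspace_diff[OF sub] by blast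
  then have psi_w: "\<bar>\<psi> w\<bar> \<le> \<mu>0 * e powr (p - 1) * norm w"
    unfolding \<psi>_def e_def res_def v_def[symmetric]
    by (rule step_functional_bound[OF sub sm r_gt p_gt mu0_pos v])
  have psi_v: "\<psi> v = \<mu>0 * e powr p"
    unfolding \<psi>_def e_def res_def v_def[symmetric]
    by (rule step_functional_self[OF sub sm r_gt p_gt mu0_pos v])
  have change: "blinfun_apply (upd \<delta> yd i \<xi> - \<xi>) (X \<xi> - z) = \<psi> w - \<psi> v"
    unfolding w_def dual_on_diff[OF dual sub v F'_in_Y[OF i XB]]
    by (simp add: blinfun.diff_left upd_apply \<psi>_def v_def)
  have "e powr (p - 1) * norm w \<le> (\<eta> + (1 + \<eta>) / \<tau>) * e powr p"
  proof (cases "e = 0")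
    case False
    then have ev: "e = norm v" "\<tau> * \<delta> < e"
      by (auto simp: e_def res_def active_norm_def v_def split: if_splits)
    \<comment> \<open>Data noise minus the linearisation error at the solution \<open>z\<close>; the
      cone condition bounds the latter.\<close>
    have "w = (y i - yd i) - (F i z - F i (X \<xi>) - blinfun_apply (F' i (X \<xi>)) (z - X \<xi>))"
      by (simp add: w_def v_def Fz blinfun.diff_right)
    then have "norm w \<le> norm (y i - yd i)
        + norm (F i z - F i (X \<xi>) - blinfun_apply (F' i (X \<xi>)) (z - X \<xi>))"
      using norm_triangle_ineq4 by simp
    also have "\<dots> \<le> \<delta> + \<eta> * norm (F i z - F i (X \<xi>))"
      using tangential_cone[OF i zB XB] yd by (simp add: norm_minus_commute)
    also have "norm (F i z - F i (X \<xi>)) \<le> \<delta> + e"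
      using norm_triangle_ineq4[of "y i - yd i" v] yd(1) by (simp add: Fz v_def ev(1) norm_minus_commute)
    also have "\<delta> + \<eta> * (\<delta> + e) = \<eta> * e + (1 + \<eta>) * \<delta>" by (simp add: algebra_simps)
    \<comment> \<open>The step is active, so the residual dominates the noise level.\<close>
    also have "\<delta> \<le> e / \<tau>" using ev(2) tau_gt by (simp add: field_simps)
    also have "\<eta> * e + (1 + \<eta>) * (e / \<tau>) = (\<eta> + (1 + \<eta>) / \<tau>) * e" by (simp add: field_simps)
    finally have w: "norm w \<le> (\<eta> + (1 + \<eta>) / \<tau>) * e" using eta by (simp add: mult_left_mono)
    then have "e powr (p - 1) * norm w \<le> e powr (p - 1) * ((\<eta> + (1 + \<eta>) / \<tau>) * e)"
      by (intro mult_left_mono) auto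
    also have "\<dots> = (\<eta> + (1 + \<eta>) / \<tau>) * e powr p"
      unfolding e(2)[symmetric] by (simp only: mult_ac)
    finally show ?thesis .
  qed simp
  then have "\<mu>0 * (e powr (p - 1) * norm w) \<le> \<mu>0 * ((\<eta> + (1 + \<eta>) / \<tau>) * e powr p)"
    using mu0_pos by (intro mult_left_mono) auto
  then have "\<psi> w - \<psi> v \<le> - (1 - \<eta> - (1 + \<eta>) / \<tau>) * \<mu>0 * e powr p"
    using psi_w psi_v by (simp add: algebra_simps)
  then show ?thesis
    using D_change[of "upd \<delta> yd i \<xi>" z \<xi>] D1 unfolding change e_def[symmetric] \<kappa>_def
    by (simp add: algebra_simps)
qed

end

section \<open>Sweeps, outer iterations and the stopping index\<close>

primrec sweep :: "real \<Rightarrow> (nat \<Rightarrow> 'b) \<Rightarrow> ('a \<Rightarrow>\<^sub>L real) \<Rightarrow> nat \<Rightarrow> ('a \<Rightarrow>\<^sub>L real)" where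
  "sweep \<delta> yd \<xi> 0 = \<xi>"
| "sweep \<delta> yd \<xi> (Suc i) = upd \<delta> yd i (sweep \<delta> yd \<xi> i)"

primrec dual_iter :: "real \<Rightarrow> (nat \<Rightarrow> 'b) \<Rightarrow> nat \<Rightarrow> ('a \<Rightarrow>\<^sub>L real)" where
  "dual_iter \<delta> yd 0 = \<xi>0"
| "dual_iter \<delta> yd (Suc n) = sweep \<delta> yd (dual_iter \<delta> yd n) N"

definition resid :: "real \<Rightarrow> (nat \<Rightarrow> 'b) \<Rightarrow> nat \<Rightarrow> nat \<Rightarrow> real" where
  "resid \<delta> yd n i = res \<delta> yd i (sweep \<delta> yd (dual_iter \<delta> yd n) i)"

lemma resid_nonneg: "0 \<le> resid \<delta> yd n i"
  by (simp add: resid_def res_nonneg)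

context
  fixes \<delta> yd
  assumes noisy: "noisy \<delta> yd"
begin

text \<open>The facts are proved together because descent keeps the iterate in the ball, which the
  next substep requires. The third one identifies \<open>sweep\<close> with the inner loop of the
  algorithm.\<close>

lemma sweep_descent:
  assumes "D \<xi> xdag \<le> c0 * \<rho> powr p" "i \<le> N"
  shows "X (sweep \<delta> yd \<xi> i) \<in> B \<and>
    (\<forall>z. sol z \<longrightarrow> D (sweep \<delta> yd \<xi> i) z
       + \<kappa> * \<mu>0 * (\<Sum>j<i. res \<delta> yd j (sweep \<delta> yd \<xi> j) powr p) \<le> D \<xi> z) \<and>
    lk_inner Y F F' \<Theta> p r \<tau> \<mu>0 \<delta> yd (\<xi>, X \<xi>) i = (sweep \<delta> yd \<xi> i, X (sweep \<delta> yd \<xi> i)) \<and>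
    norm (X (sweep \<delta> yd \<xi> i) - X \<xi>) \<le> L * (\<Sum>j<i. res \<delta> yd j (sweep \<delta> yd \<xi> j))"
  using assms(2)
proof (induction i)
  case 0
  then show ?case using X_in_B[OF assms(1)] by simp
next
  case (Suc i)
  let ?\<xi> = "sweep \<delta> yd \<xi> i" and ?e = "res \<delta> yd i (sweep \<delta> yd \<xi> i)"
  from Suc have i: "i < N" and XB: "X ?\<xi> \<in> B"
    and IH: "\<And>z. sol z \<Longrightarrow> D ?\<xi> z
       + \<kappa> * \<mu>0 * (\<Sum>j<i. res \<delta> yd j (sweep \<delta> yd \<xi> j) powr p) \<le> D \<xi> z"
    and eq: "lk_inner Y F F' \<Theta> p r \<tau> \<mu>0 \<delta> yd (\<xi>, X \<xi>) i = (?\<xi>, X ?\<xi>)"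
    and dist: "norm (X ?\<xi> - X \<xi>) \<le> L * (\<Sum>j<i. res \<delta> yd j (sweep \<delta> yd \<xi> j))"
    by auto
  have desc: "D (upd \<delta> yd i ?\<xi>) z
       + \<kappa> * \<mu>0 * (\<Sum>j<Suc i. res \<delta> yd j (sweep \<delta> yd \<xi> j) powr p) \<le> D \<xi> z" if "sol z" for z
    using upd_D[OF noisy i XB that] IH[OF that] by (simp add: distrib_left)
  have "0 \<le> \<kappa> * \<mu>0 * (\<Sum>j<Suc i. res \<delta> yd j (sweep \<delta> yd \<xi> j) powr p)"
    using kappa_pos mu0_pos by (intro mult_nonneg_nonneg sum_nonneg) auto
  then have "X (upd \<delta> yd i ?\<xi>) \<in> B"
    using desc[OF sol_xdag] assms(1) by (intro X_in_B) linarith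
  moreover have "norm (X (upd \<delta> yd i ?\<xi>) - X \<xi>) \<le> L * (\<Sum>j<Suc i. res \<delta> yd j (sweep \<delta> yd \<xi> j))"
    using upd_X[OF noisy i XB] dist norm_triangle_ineq[of "X (upd \<delta> yd i ?\<xi>) - X ?\<xi>" "X ?\<xi> - X \<xi>"]
    by (simp add: distrib_left)
  ultimately show ?case
    using desc lk_step_eq[OF noisy i XB] eq by simp
qed

lemma dual_iter_invariant:
  "D (dual_iter \<delta> yd n) xdag \<le> c0 * \<rho> powr p \<and>
   lk_iter N Y F F' \<Theta> p r \<tau> \<mu>0 \<delta> yd (\<xi>0, x0) n = (dual_iter \<delta> yd n, X (dual_iter \<delta> yd n))"
proof (induction n)
  case 0
  then show ?case using D_xdag_le by (simp add: x0_def)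
next
  case (Suc n)
  then have I: "D (dual_iter \<delta> yd n) xdag \<le> c0 * \<rho> powr p" by simp
  have "0 \<le> \<kappa> * \<mu>0 * (\<Sum>j<N. resid \<delta> yd n j powr p)"
    using kappa_pos mu0_pos by (intro mult_nonneg_nonneg sum_nonneg) auto
  then show ?case
    using sweep_descent[OF I order_refl] sol_xdag I Suc unfolding resid_def by fastforce
qed

lemma sweep_in_B: "i \<le> N \<Longrightarrow> X (sweep \<delta> yd (dual_iter \<delta> yd n) i) \<in> B"
  using sweep_descent[OF conjunct1[OF dual_iter_invariant]] by blast

lemma dual_iter_in_B: "X (dual_iter \<delta> yd n) \<in> B"
  using sweep_in_B[of 0 n] by simp

lemma lk_inner_eq: "i \<le> N \<Longrightarrow>
   lk_inner Y F F' \<Theta> p r \<tau> \<mu>0 \<delta> yd (lk_iter N Y F F' \<Theta> p r \<tau> \<mu>0 \<delta> yd (\<xi>0, x0) n) i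
     = (sweep \<delta> yd (dual_iter \<delta> yd n) i, X (sweep \<delta> yd (dual_iter \<delta> yd n) i))"
  using sweep_descent[OF conjunct1[OF dual_iter_invariant]] unfolding conjunct2[OF dual_iter_invariant] by blast

lemma sweep_X_diff:
  assumes "i \<le> N"
  shows "norm (X (sweep \<delta> yd (dual_iter \<delta> yd n) i) - X (dual_iter \<delta> yd n)) \<le> L * (\<Sum>j<N. resid \<delta> yd n j)"
proof -
  have "norm (X (sweep \<delta> yd (dual_iter \<delta> yd n) i) - X (dual_iter \<delta> yd n)) \<le> L * (\<Sum>j<i. resid \<delta> yd n j)"
    using sweep_descent[OF conjunct1[OF dual_iter_invariant] assms] by (simp add: resid_def)
  also have "\<dots> \<le> L * (\<Sum>j<N. resid \<delta> yd n j)"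
    using L_nonneg resid_nonneg assms by (intro mult_left_mono sum_mono2) auto
  finally show ?thesis .
qed

lemma dual_iter_descent:
  assumes "sol z"
  shows "D (dual_iter \<delta> yd (Suc n)) z + \<kappa> * \<mu>0 * (\<Sum>j<N. resid \<delta> yd n j powr p) \<le> D (dual_iter \<delta> yd n) z"
  using sweep_descent[OF conjunct1[OF dual_iter_invariant] order_refl] assms by (simp add: resid_def)

lemma dual_iter_descent_sum:
  assumes "sol z" "k \<le> l"
  shows "D (dual_iter \<delta> yd l) z + \<kappa> * \<mu>0 * (\<Sum>n=k..<l. \<Sum>j<N. resid \<delta> yd n j powr p)
    \<le> D (dual_iter \<delta> yd k) z"
  using assms(2)
proof (induction rule: dec_induct)
  case (step l)
  then show ?case using dual_iter_descent[OF assms(1), of l] by (simp add: distrib_left)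
qed simp

lemma dual_iter_mono:
  assumes "sol z" "k \<le> l"
  shows "D (dual_iter \<delta> yd l) z \<le> D (dual_iter \<delta> yd k) z"
proof -
  have "0 \<le> \<kappa> * \<mu>0 * (\<Sum>n=k..<l. \<Sum>j<N. resid \<delta> yd n j powr p)"
    using kappa_pos mu0_pos by (intro mult_nonneg_nonneg sum_nonneg) auto
  then show ?thesis using dual_iter_descent_sum[OF assms] by linarith
qed

lemma stepsize_zero_iff:
  assumes "i < N"
  shows "lk_stepsize p r \<tau> \<mu>0 \<delta>
     (F i (snd (lk_inner Y F F' \<Theta> p r \<tau> \<mu>0 \<delta> yd
        (lk_iter N Y F F' \<Theta> p r \<tau> \<mu>0 \<delta> yd (\<xi>0, x0) n) i)) - yd i) = 0 \<longleftrightarrow> resid \<delta> yd n i = 0"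
  using assms mu0_pos unfolding lk_inner_eq[OF less_imp_le[OF assms]]
  by (auto simp: lk_stepsize_def resid_def res_def active_norm_def)

lemma lk_stop_eq: "lk_stop N Y F F' \<Theta> p r \<tau> \<mu>0 \<delta> yd (\<xi>0, x0) = (LEAST n. \<forall>i<N. resid \<delta> yd n i = 0)"
  unfolding lk_stop_def by (simp add: stepsize_zero_iff)

text \<open>Before stopping, each sweep has an active residual above
  \<open>\<tau> * \<delta>\<close> and lowers \<open>D\<close> at \<open>xdag\<close> by at least
  the fixed \<open>t > 0\<close>; a nonnegative quantity allows this only finitely often.\<close>

lemma discrepancy_met:
  assumes "\<delta> > 0"
  shows "\<exists>n. \<forall>i<N. resid \<delta> yd n i = 0"
proof (rule ccontr)
  assume "\<nexists>n. \<forall>i<N. resid \<delta> yd n i = 0"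
  then have "\<exists>i<N. resid \<delta> yd n i \<noteq> 0" for n by blast
  then obtain f where f: "\<And>n. f n < N" "\<And>n. resid \<delta> yd n (f n) \<noteq> 0" by metis
  define t where "t = \<kappa> * \<mu>0 * (\<tau> * \<delta>) powr p"
  have t: "t > 0" using assms tau_gt kappa_pos mu0_pos by (simp add: t_def)
  obtain m where m: "D \<xi>0 xdag < real m * t" using reals_Archimedean3[OF t] by blast
  have low: "(\<tau> * \<delta>) powr p \<le> (\<Sum>j<N. resid \<delta> yd n j powr p)" for n
  proof -
    have "\<tau> * \<delta> \<le> resid \<delta> yd n (f n)"
      using f(2)[of n] by (auto simp: resid_def res_def active_norm_def split: if_splits)
    then have "(\<tau> * \<delta>) powr p \<le> resid \<delta> yd n (f n) powr p"
      using assms tau_gt p_ge by (intro powr_mono2) auto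
    also have "\<dots> \<le> (\<Sum>j<N. resid \<delta> yd n j powr p)"
      using f(1)[of n] by (intro member_le_sum) auto
    finally show ?thesis .
  qed
  have "real m * (\<tau> * \<delta>) powr p = (\<Sum>n=0..<m. (\<tau> * \<delta>) powr p)" by simp
  also have "\<dots> \<le> (\<Sum>n=0..<m. \<Sum>j<N. resid \<delta> yd n j powr p)"
    using low by (intro sum_mono) auto
  finally have "\<kappa> * \<mu>0 * (real m * (\<tau> * \<delta>) powr p)
      \<le> \<kappa> * \<mu>0 * (\<Sum>n=0..<m. \<Sum>j<N. resid \<delta> yd n j powr p)"
    using kappa_pos mu0_pos by (intro mult_left_mono) auto
  then have "real m * t \<le> \<kappa> * \<mu>0 * (\<Sum>n=0..<m. \<Sum>j<N. resid \<delta> yd n j powr p)"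
    by (simp add: t_def mult_ac)
  then show False
    using dual_iter_descent_sum[OF sol_xdag, of 0 m] D_nonneg[OF xdag_dom, of "dual_iter \<delta> yd m"] m by simp
qed

end

section \<open>Convergence for exact data\<close>

abbreviation \<xi>n :: "nat \<Rightarrow> ('a \<Rightarrow>\<^sub>L real)" where "\<xi>n n \<equiv> dual_iter 0 y n"

abbreviation \<xi>ni :: "nat \<Rightarrow> nat \<Rightarrow> ('a \<Rightarrow>\<^sub>L real)" where "\<xi>ni n i \<equiv> sweep 0 y (dual_iter 0 y n) i"

abbreviation en :: "nat \<Rightarrow> nat \<Rightarrow> real" where "en n i \<equiv> resid 0 y n i"

definition V :: "nat \<Rightarrow> real" where "V n = (\<Sum>i<N. en n i)"

lemma en_eq: "en n i = norm (F i (X (\<xi>ni n i)) - y i)"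
  by (simp add: resid_def res_exact)

lemma en_le_V: "i < N \<Longrightarrow> en n i \<le> V n"
  unfolding V_def using resid_nonneg by (intro member_le_sum) auto

lemma V_nonneg: "0 \<le> V n"
  unfolding V_def using resid_nonneg by (intro sum_nonneg) auto

text \<open>By pigeonhole some residual is at least the average \<open>V n / N\<close>; this gives a
  crude form of Jensen's inequality with constant \<open>N powr p\<close>.\<close>

lemma V_powr_le: "V n powr p \<le> real N powr p * (\<Sum>i<N. en n i powr p)"
proof (cases "V n = 0")
  case True
  then show ?thesis by (simp add: sum_nonneg)
next
  case False
  have "\<exists>i<N. V n \<le> real N * en n i"
  proof (rule ccontr)
    assume "\<not> (\<exists>i<N. V n \<le> real N * en n i)"
    then have less: "\<And>i. i < N \<Longrightarrow> real N * en n i < V n" by (auto simp: not_le)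
    have N: "N > 0" using False by (auto simp: V_def intro!: Nat.gr0I)
    have "real N * V n = (\<Sum>i<N. real N * en n i)" by (simp add: V_def sum_distrib_left)
    also have "\<dots> < (\<Sum>i<N. V n)" using less N by (intro sum_strict_mono) auto
    finally show False by simp
  qed
  then obtain i where i: "i < N" "V n \<le> real N * en n i" by blast
  then have "V n powr p \<le> (real N * en n i) powr p"
    using V_nonneg p_ge by (intro powr_mono2) auto
  also have "\<dots> = real N powr p * en n i powr p" by (simp add: powr_mult)
  also have "en n i powr p \<le> (\<Sum>i<N. en n i powr p)"
    using i(1) by (intro member_le_sum) auto
  finally show ?thesis by (simp add: mult_left_mono)
qed

lemma sum_V_powr_le:
  assumes "k \<le> l"
  shows "(\<Sum>n=k..<l. V n powr p) \<le> real N powr p / (\<kappa> * \<mu>0) * (D (\<xi>n k) xdag - D (\<xi>n l) xdag)"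
proof -
  have "(\<Sum>n=k..<l. V n powr p) \<le> real N powr p * (\<Sum>n=k..<l. \<Sum>i<N. en n i powr p)"
    unfolding sum_distrib_left[of "real N powr p" _ "{k..<l}"] by (intro sum_mono V_powr_le)
  also have "(\<Sum>n=k..<l. \<Sum>i<N. en n i powr p) \<le> (D (\<xi>n k) xdag - D (\<xi>n l) xdag) / (\<kappa> * \<mu>0)"
    using dual_iter_descent_sum[OF noisy_exact sol_xdag assms] kappa_pos mu0_pos
    by (simp add: field_simps)
  finally show ?thesis by (simp add: mult_left_mono)
qed

definition dlim :: real where "dlim = (INF n. D (\<xi>n n) xdag)"

lemma D_xdag_tendsto: "(\<lambda>n. D (\<xi>n n) xdag) \<longlonglongrightarrow> dlim"
  unfolding dlim_def
proof (rule LIMSEQ_decseq_INF)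
  show "bdd_below (range (\<lambda>n. D (\<xi>n n) xdag))"
    using D_nonneg[OF xdag_dom] by (intro bdd_belowI2)
  show "decseq (\<lambda>n. D (\<xi>n n) xdag)"
    unfolding decseq_def using dual_iter_mono[OF noisy_exact sol_xdag] by blast
qed

lemma dlim_le: "dlim \<le> D (\<xi>n n) xdag"
  unfolding dlim_def using D_nonneg[OF xdag_dom] by (intro cINF_lower bdd_belowI2) auto

lemma V_tendsto: "V \<longlonglongrightarrow> 0"
proof -
  let ?C = "real N powr p / (\<kappa> * \<mu>0)"
  have le: "V n powr p \<le> ?C * (D (\<xi>n n) xdag - D (\<xi>n (Suc n)) xdag)" for n
    using sum_V_powr_le[of n "Suc n"] by simp
  have "(\<lambda>n. ?C * (D (\<xi>n n) xdag - D (\<xi>n (Suc n)) xdag)) \<longlonglongrightarrow> ?C * (dlim - dlim)"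
    by (intro tendsto_intros D_xdag_tendsto LIMSEQ_Suc)
  then have lim: "(\<lambda>n. ?C * (D (\<xi>n n) xdag - D (\<xi>n (Suc n)) xdag)) \<longlonglongrightarrow> 0" by simp
  have "(\<lambda>n. V n powr p) \<longlonglongrightarrow> 0"
    by (rule tendsto_sandwich[OF always_eventually always_eventually tendsto_const lim])
      (simp, intro allI le)
  then have "(\<lambda>n. (V n powr p) powr (1 / p)) \<longlonglongrightarrow> 0"
    by (rule tendsto_zero_powrI[OF _ tendsto_const]) (use p_ge in auto)
  then show ?thesis using p_ge V_nonneg by (simp add: powr_powr)
qed

text \<open>A vanishing residual makes the update zero. The disjunct \<open>i > N\<close> restricts
  the claim to actual substeps while the induction runs over all \<open>i\<close>.\<close>

lemma stationary:
  assumes "V n = 0"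
  shows "\<xi>ni n i = \<xi>n n \<or> i > N"
proof (induction i)
  case (Suc i)
  show ?case
  proof (cases "i < N")
    case True
    then have "en n i = 0"
      using en_le_V[OF True, of n] assms resid_nonneg[of 0 y n i] by simp
    then have "norm (upd 0 y i (\<xi>ni n i) - \<xi>ni n i) \<le> 0"
      using upd_norm[OF noisy_exact True sweep_in_B[OF noisy_exact less_imp_le[OF True], of n]] p_gt
      by (simp add: resid_def)
    then show ?thesis using Suc True by simp
  qed simp
qed simp

lemma stationary_later:
  assumes "V n = 0" "n \<le> m"
  shows "\<xi>n m = \<xi>n n" "V m = 0"
proof -
  have step: "\<xi>n (Suc k) = \<xi>n k" "V (Suc k) = 0" if "V k = 0" for k
  proof -
    show eq: "\<xi>n (Suc k) = \<xi>n k" using stationary[OF that, of N] by simp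
    show "V (Suc k) = 0"
      using that unfolding V_def resid_def eq .
  qed
  have "\<xi>n m = \<xi>n n \<and> V m = 0"
    using assms(2,1) by (induction rule: dec_induct) (auto simp: step simp del: dual_iter.simps)
  then show "\<xi>n m = \<xi>n n" "V m = 0" by auto
qed

lemma record_minima: "\<exists>l\<ge>m. \<forall>n\<le>l. V l \<le> V n"
  using V_tendsto V_nonneg stationary_later(2)[OF _ le_SucI[OF order_refl]]
  by (rule infinitely_many_record_minima)

text \<open>\<open>V n\<close> measures residuals at the intermediate iterates of a sweep. Moving
  back to its first iterate costs at most \<open>L * V n\<close> in the space, hence
  \<open>L / (1 - \<eta>) * V n\<close> in the residual.\<close>

lemma residual_le_V:
  assumes "i < N"
  shows "norm (F i (X (\<xi>n n)) - y i) \<le> (1 + L / (1 - \<eta>)) * V n"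
proof -
  have "norm (F i (X (\<xi>n n)) - y i)
      \<le> norm (F i (X (\<xi>n n)) - F i (X (\<xi>ni n i))) + norm (F i (X (\<xi>ni n i)) - y i)"
    using norm_triangle_ineq[of "F i (X (\<xi>n n)) - F i (X (\<xi>ni n i))" "F i (X (\<xi>ni n i)) - y i"] by simp
  also have "norm (F i (X (\<xi>ni n i)) - y i) \<le> V n"
    using en_le_V[OF assms] by (simp add: en_eq)
  also have "norm (F i (X (\<xi>n n)) - F i (X (\<xi>ni n i))) \<le> norm (X (\<xi>n n) - X (\<xi>ni n i)) / (1 - \<eta>)"
    using assms by (intro F_lipschitz dual_iter_in_B sweep_in_B noisy_exact) auto
  also have "\<dots> \<le> (L * V n) / (1 - \<eta>)"
    using sweep_X_diff[OF noisy_exact, of i n] assms eta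
    by (intro divide_right_mono) (auto simp: norm_minus_commute V_def)
  finally show ?thesis by (simp add: algebra_simps)
qed

text \<open>The case \<open>K = 0\<close> is used as well: a direction killed by all derivatives
  keeps its pairing during the sweep.\<close>

lemma sweep_pairing_le:
  assumes "\<And>i. i < N \<Longrightarrow> norm (blinfun_apply (F' i (X (\<xi>ni n i))) h) \<le> K" "K \<ge> 0" "i \<le> N"
  shows "\<bar>blinfun_apply (\<xi>ni n i - \<xi>n n) h\<bar> \<le> real i * (\<mu>0 * V n powr (p - 1) * K)"
  using assms(3)
proof (induction i)
  case (Suc i)
  then have i: "i < N" by simp
  have "\<bar>blinfun_apply (\<xi>ni n (Suc i) - \<xi>ni n i) h\<bar>
      \<le> \<mu>0 * en n i powr (p - 1) * norm (blinfun_apply (F' i (X (\<xi>ni n i))) h)"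
    using upd_apply_diff[OF noisy_exact i sweep_in_B[OF noisy_exact]] i by (simp add: resid_def)
  also have "\<dots> \<le> \<mu>0 * V n powr (p - 1) * K"
    using assms(1)[OF i] mu0_pos p_ge en_le_V[OF i] resid_nonneg
    by (intro mult_mono mult_left_mono powr_mono2) auto
  finally show ?case
    using Suc.IH i by (simp add: blinfun.diff_left algebra_simps)
qed simp

text \<open>Each derivative at an intermediate iterate acts on \<open>X (\<xi>n l) - z\<close>,
  split at that iterate. The residual at \<open>l\<close> is bounded by a multiple of
  \<open>V l\<close>, which record minimality replaces by \<open>V n\<close>, so sweep
  \<open>n\<close> contributes a multiple of \<open>V n powr p\<close>.\<close>

lemma dual_iter_pairing_le:
  assumes z: "sol z" and "k \<le> l" and rec: "\<And>n. n \<le> l \<Longrightarrow> V l \<le> V n"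
  defines "C \<equiv> real N * \<mu>0 * ((1 + \<eta>) * (3 + L / (1 - \<eta>)))"
  shows "\<bar>blinfun_apply (\<xi>n l - \<xi>n k) (X (\<xi>n l) - z)\<bar> \<le> C * (\<Sum>n=k..<l. V n powr p)"
proof -
  have C1: "0 \<le> 1 + L / (1 - \<eta>)" using L_nonneg eta by simp
  have pair_step: "\<bar>blinfun_apply (\<xi>n (Suc n) - \<xi>n n) (X (\<xi>n l) - z)\<bar> \<le> C * V n powr p" if "n < l" for n
  proof -
    \<comment> \<open>The constant is \<open>2 + L / (1 - \<eta>)\<close> from the part towards
      \<open>X (\<xi>n l)\<close> plus 1 from the part towards \<open>z\<close>.\<close>
    let ?K = "(1 + \<eta>) * ((3 + L / (1 - \<eta>)) * V n)"
    have bound: "norm (blinfun_apply (F' i (X (\<xi>ni n i))) (X (\<xi>n l) - z)) \<le> ?K" if i: "i < N" for i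
    proof -
      have B: "X (\<xi>ni n i) \<in> B" "X (\<xi>n l) \<in> B" "z \<in> B"
        using sweep_in_B[OF noisy_exact] dual_iter_in_B[OF noisy_exact] i z by (auto simp: sol_def)
      let ?x = "X (\<xi>ni n i)"
      have "norm (blinfun_apply (F' i ?x) (X (\<xi>n l) - z))
          \<le> norm (blinfun_apply (F' i ?x) (X (\<xi>n l) - ?x)) + norm (blinfun_apply (F' i ?x) (z - ?x))"
        using norm_triangle_ineq4[of "blinfun_apply (F' i ?x) (X (\<xi>n l) - ?x)"
          "blinfun_apply (F' i ?x) (z - ?x)"] by (simp add: blinfun.diff_right)
      also have "\<dots> \<le> (1 + \<eta>) * norm (F i (X (\<xi>n l)) - F i ?x) + (1 + \<eta>) * norm (F i z - F i ?x)"
        by (intro add_mono F'_diff_le i B)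
      also have "\<dots> \<le> (1 + \<eta>) * ((2 + L / (1 - \<eta>)) * V n) + (1 + \<eta>) * V n"
      proof (intro add_mono mult_left_mono)
        have x: "norm (F i ?x - y i) \<le> V n"
          using en_le_V[OF i, of n] by (simp add: en_eq)
        then show "norm (F i z - F i ?x) \<le> V n"
          by (simp add: sol_F[OF z i] norm_minus_commute)
        have "norm (F i (X (\<xi>n l)) - F i ?x) \<le> norm (F i (X (\<xi>n l)) - y i) + norm (F i ?x - y i)"
          using norm_triangle_ineq4[of "F i (X (\<xi>n l)) - y i" "F i ?x - y i"] by simp
        moreover have "(1 + L / (1 - \<eta>)) * V l \<le> (1 + L / (1 - \<eta>)) * V n"
          using rec[of n] \<open>n < l\<close> C1 by (intro mult_left_mono) auto
        ultimately show "norm (F i (X (\<xi>n l)) - F i ?x) \<le> (2 + L / (1 - \<eta>)) * V n"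
          using residual_le_V[OF i, of l] x by (simp add: algebra_simps)
      qed (use eta in auto)
      also have "\<dots> = ?K" by (simp add: algebra_simps)
      finally show ?thesis .
    qed
    have "0 \<le> ?K" using C1 eta V_nonneg by simp
    then have "\<bar>blinfun_apply (\<xi>ni n N - \<xi>n n) (X (\<xi>n l) - z)\<bar> \<le> real N * (\<mu>0 * V n powr (p - 1) * ?K)"
      by (intro sweep_pairing_le bound) auto
    also have "\<dots> = C * (V n * V n powr (p - 1))" by (simp add: C_def mult_ac)
    also have "V n * V n powr (p - 1) = V n powr p"
      using powr_mult_base[of "V n" "p - 1"] V_nonneg by simp
    finally show ?thesis by simp
  qed
  \<comment> \<open>The summation end \<open>m\<close> varies while the tested vector stays at
    \<open>l\<close>; induction on \<open>l\<close> itself would change both.\<close>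
  have "\<bar>blinfun_apply (\<xi>n m - \<xi>n k) (X (\<xi>n l) - z)\<bar> \<le> C * (\<Sum>n=k..<m. V n powr p)"
    if "k \<le> m" "m \<le> l" for m
    using that
  proof (induction rule: dec_induct)
    case (step m)
    have "\<bar>blinfun_apply (\<xi>n m - \<xi>n k) (X (\<xi>n l) - z)\<bar> \<le> C * (\<Sum>n=k..<m. V n powr p)"
      using step by simp
    then show ?case
      using pair_step[of m] step by (simp add: blinfun.diff_left algebra_simps)
  qed simp
  then show ?thesis using \<open>k \<le> l\<close> by simp
qed

lemma exact_limit_exists:
  obtains xs where "sol xs" "(\<lambda>n. D (\<xi>n n) xs) \<longlonglongrightarrow> 0"
proof -
  define C where "C = real N * \<mu>0 * ((1 + \<eta>) * (3 + L / (1 - \<eta>)))"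
  define C' where "C' = 1 + C * (real N powr p / (\<kappa> * \<mu>0))"
  \<comment> \<open>\<open>dlim\<close> replaces the value at the record index, which makes the
    bound in \<open>key\<close> independent of \<open>m\<close>.\<close>
  define g where "g n = C' * (D (\<xi>n n) xdag - dlim)" for n
  have C: "C \<ge> 0" using L_nonneg eta mu0_pos by (simp add: C_def)
  then have C': "C' \<ge> 0" using kappa_pos mu0_pos by (simp add: C'_def)
  have "g \<longlonglongrightarrow> C' * (dlim - dlim)"
    unfolding g_def by (intro tendsto_intros D_xdag_tendsto)
  then have g_lim: "g \<longlonglongrightarrow> 0" by simp
  have "\<exists>l. \<forall>m. l m \<ge> m \<and> (\<forall>n\<le>l m. V (l m) \<le> V n)"
    using record_minima by metis
  then obtain l where l: "\<And>m. l m \<ge> m" "\<And>m n. n \<le> l m \<Longrightarrow> V (l m) \<le> V n" by blast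
  have key: "D (\<xi>n k) (X (\<xi>n (l m))) \<le> g k" if "k \<le> l m" for k m
  proof -
    let ?d = "D (\<xi>n k) xdag - D (\<xi>n (l m)) xdag"
    have "D (\<xi>n k) (X (\<xi>n (l m)))
        = ?d + blinfun_apply (\<xi>n (l m) - \<xi>n k) (X (\<xi>n (l m)) - xdag)"
      using D_change[of "\<xi>n k" xdag "\<xi>n (l m)"] by (simp add: blinfun.diff_left)
    also have "\<dots> \<le> ?d + C * (\<Sum>n=k..<l m. V n powr p)"
      using dual_iter_pairing_le[OF sol_xdag that l(2)] unfolding C_def by linarith
    also have "\<dots> \<le> ?d + C * (real N powr p / (\<kappa> * \<mu>0) * ?d)"
      using sum_V_powr_le[OF that] C by (intro add_left_mono mult_left_mono)
    also have "\<dots> = C' * ?d" by (simp add: C'_def algebra_simps)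
    also have "\<dots> \<le> g k"
      unfolding g_def using dlim_le C' by (intro mult_left_mono) auto
    finally show ?thesis .
  qed
  have "Cauchy (\<lambda>m. X (\<xi>n (l m)))"
  proof (rule CauchyI)
    fix e :: real assume e: "e > 0"
    then have "c0 * (e / 3) powr p > 0" using c0_pos by simp
    then obtain k where k: "g k < c0 * (e / 3) powr p"
      using eventually_happens'[OF _ order_tendstoD(2)[OF g_lim]] sequentially_bot by blast
    have near: "norm (X (\<xi>n (l m)) - X (\<xi>n k)) \<le> e / 3" if "m \<ge> k" for m
      using key[of k m] l(1)[of m] that k e by (intro norm_le_of_D_le X_dom) auto
    have "norm (X (\<xi>n (l a)) - X (\<xi>n (l b))) < e" if "a \<ge> k" "b \<ge> k" for a b
      using norm_triangle_ineq4[of "X (\<xi>n (l a)) - X (\<xi>n k)" "X (\<xi>n (l b)) - X (\<xi>n k)"]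
        near[OF that(1)] near[OF that(2)] e by simp
    then show "\<exists>M. \<forall>a\<ge>M. \<forall>b\<ge>M. norm (X (\<xi>n (l a)) - X (\<xi>n (l b))) < e" by blast
  qed
  then obtain xs where xs: "(\<lambda>m. X (\<xi>n (l m))) \<longlonglongrightarrow> xs"
    using Cauchy_convergent convergent_def by blast
  have D_le: "xs \<in> dom_fun \<Theta> \<and> D (\<xi>n k) xs \<le> g k" for k
  proof -
    have lim: "(\<lambda>m. X (\<xi>n (l (m + k)))) \<longlonglongrightarrow> xs" using xs by (rule LIMSEQ_ignore_initial_segment)
    have le: "D (\<xi>n k) (X (\<xi>n (l (m + k)))) \<le> g k" for m
      using key[of k "m + k"] l(1)[of "m + k"] by simp
    show ?thesis using D_le_limit[OF lim X_dom le] by simp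
  qed
  have xsB: "xs \<in> B"
    by (rule Lim_in_closed_set[OF closed_cball always_eventually _ xs])
      (simp_all only: dual_iter_in_B[OF noisy_exact] simp_thms sequentially_bot)
  have "F i xs = y i" if i: "i < N" for i
  proof -
    have "(\<lambda>m. F i (X (\<xi>n (l m)))) \<longlonglongrightarrow> F i xs"
      by (rule continuous_on_tendsto_compose[OF F_cont[OF i] xs xsB])
        (simp only: dual_iter_in_B[OF noisy_exact] eventually_True)
    then have lim1: "(\<lambda>m. norm (F i (X (\<xi>n (l m))) - y i)) \<longlonglongrightarrow> norm (F i xs - y i)"
      by (intro tendsto_intros)
    have "filterlim l at_top sequentially"
      by (rule filterlim_at_top_mono[OF filterlim_ident]) (simp add: l(1))
    then have "(\<lambda>m. V (l m)) \<longlonglongrightarrow> 0" by (rule filterlim_compose[OF V_tendsto])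
    then have lim2: "(\<lambda>m. (1 + L / (1 - \<eta>)) * V (l m)) \<longlonglongrightarrow> 0" by (rule tendsto_mult_right_zero)
    have "norm (F i xs - y i) \<le> 0"
      using LIMSEQ_le[OF lim1 lim2] residual_le_V[OF i] by blast
    then show ?thesis by simp
  qed
  then have "sol xs" using xsB D_le by (simp add: sol_def solves_def)
  moreover have "(\<lambda>n. D (\<xi>n n) xs) \<longlonglongrightarrow> 0"
    by (rule tendsto_sandwich[OF always_eventually always_eventually tendsto_const g_lim])
      (use D_le D_nonneg in auto)
  ultimately show thesis by (rule that)
qed

lemma D_tendsto_0_X_tendsto:
  assumes "((\<lambda>k. D (\<xi> k) z) \<longlongrightarrow> 0) f" "z \<in> dom_fun \<Theta>"
  shows "((\<lambda>k. X (\<xi> k)) \<longlongrightarrow> z) f"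
proof (rule tendstoI)
  fix e :: real assume e: "e > 0"
  then have "c0 * (e / 2) powr p > 0" using c0_pos by simp
  from order_tendstoD(2)[OF assms(1) this]
  show "eventually (\<lambda>k. dist (X (\<xi> k)) z < e) f"
  proof eventually_elim
    case (elim k)
    then have "norm (z - X (\<xi> k)) \<le> e / 2"
      using e by (intro norm_le_of_D_le assms(2)) auto
    then show ?case using e by (simp add: dist_norm norm_minus_commute)
  qed
qed

lemma exact_limit_eq_xdag:
  assumes xs: "sol xs" "(\<lambda>n. D (\<xi>n n) xs) \<longlonglongrightarrow> 0"
    and null: "\<And>i x. i < N \<Longrightarrow> x \<in> B \<Longrightarrow> null_space (F' i xdag) \<subseteq> null_space (F' i x)"
  shows "xs = xdag"
proof -
  define h where "h = xs - xdag"
  have xsB: "xs \<in> B" "xs \<in> dom_fun \<Theta>" and xdagB: "xdag \<in> B"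
    using xs(1) sol_xdag by (auto simp: sol_def)
  have h: "blinfun_apply (F' i x) h = 0" if "i < N" "x \<in> B" for i x
  proof -
    \<comment> \<open>\<open>xs\<close> and \<open>xdag\<close> have equal images, so their
      difference lies in the kernel at \<open>xdag\<close> and, by hypothesis, in the kernel at
      every point of the ball.\<close>
    have "h \<in> null_space (F' i xdag)"
      using F'_diff_le[OF that(1) xsB(1) xdagB] sol_F[OF xs(1) that(1)] sol_F[OF sol_xdag that(1)]
      by (simp add: null_space_def h_def)
    then show ?thesis using null[OF that] by (auto simp: null_space_def)
  qed
  have sweep_h: "i \<le> N \<Longrightarrow> blinfun_apply (\<xi>ni n i - \<xi>n n) h = 0" for n i
    using sweep_pairing_le[of n h 0 i] h sweep_in_B[OF noisy_exact] by simp
  have xi_h: "blinfun_apply (\<xi>n n) h = blinfun_apply \<xi>0 h" for n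
  proof (induction n)
    case (Suc n)
    then show ?case using sweep_h[of N n] by (simp add: blinfun.diff_left)
  qed simp
  have "D (\<xi>n n) xdag \<le> D (\<xi>n n) xs" for n
  proof -
    \<comment> \<open>The dual variable enters this difference only through its pairing with
      \<open>h\<close>, which never changes; thus minimality of \<open>xdag\<close> at
      \<open>\<xi>0\<close> carries over to every \<open>n\<close>.\<close>
    have "D (\<xi>n n) xs - D (\<xi>n n) xdag = D \<xi>0 xs - D \<xi>0 xdag"
      using xi_h[of n] by (simp add: D_def h_def blinfun.diff_right)
    then show ?thesis using D_xdag_minimal[OF xs(1)] by simp
  qed
  then have "(\<lambda>n. D (\<xi>n n) xdag) \<longlonglongrightarrow> 0"
    using D_nonneg[OF xdag_dom]
    by (intro tendsto_sandwich[OF always_eventually always_eventually tendsto_const xs(2)]) auto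
  then show ?thesis
    using D_tendsto_0_X_tendsto[OF xs(2) xsB(2)] D_tendsto_0_X_tendsto[OF _ xdag_dom] LIMSEQ_unique
    by blast
qed

section \<open>Stability and convergence for noisy data\<close>

context
  fixes yd :: "real \<Rightarrow> nat \<Rightarrow> 'b"
  assumes noisy: "\<And>\<delta>. \<delta> > 0 \<Longrightarrow> noisy \<delta> (yd \<delta>)"
begin

lemma data_tendsto:
  assumes "i < N"
  shows "((\<lambda>\<delta>. yd \<delta> i) \<longlongrightarrow> y i) (at_right 0)"
proof (rule tendstoI)
  fix e :: real assume "e > 0"
  then have "eventually (\<lambda>\<delta>. \<delta> < e) (at_right 0)"
    by (rule eventually_at_right_real[THEN eventually_mono]) auto
  with eventually_at_right_less[of 0] show "eventually (\<lambda>\<delta>. dist (yd \<delta> i) (y i) < e) (at_right 0)"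
    by eventually_elim (use noisy assms in \<open>force simp: noisy_def dist_norm\<close>)
qed

text \<open>Continuity of \<open>F i\<close> and \<open>F' i\<close> is available on the ball only,
  hence the membership hypotheses. The residual limit is stated separately for the threshold test in
  \<open>stopped_D_less\<close>.\<close>

lemma upd_tendsto:
  assumes i: "i < N" and lim: "(\<xi> \<longlongrightarrow> \<xi>') (at_right 0)" and B': "X \<xi>' \<in> B"
    and B: "\<And>\<delta>. \<delta> > 0 \<Longrightarrow> X (\<xi> \<delta>) \<in> B"
  shows "((\<lambda>\<delta>. upd \<delta> (yd \<delta>) i (\<xi> \<delta>)) \<longlongrightarrow> upd 0 y i \<xi>') (at_right 0)"
    and "((\<lambda>\<delta>. F i (X (\<xi> \<delta>)) - yd \<delta> i) \<longlongrightarrow> F i (X \<xi>') - y i) (at_right 0)"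
proof -
  note sub = conjunct1[OF Y_banach[OF i]]
  have evB: "eventually (\<lambda>\<delta>. X (\<xi> \<delta>) \<in> B) (at_right 0)"
    using eventually_at_right_less[of 0] by (rule eventually_mono) (rule B)
  have evY: "eventually (\<lambda>\<delta>. F i (X (\<xi> \<delta>)) - yd \<delta> i \<in> Y i) (at_right 0)"
    using eventually_at_right_less[of 0]
    by (rule eventually_mono) (use B F_in_Y[OF i] noisy i in \<open>auto simp: noisy_def intro!: subspace_diff[OF sub]\<close>)
  show res: "((\<lambda>\<delta>. F i (X (\<xi> \<delta>)) - yd \<delta> i) \<longlongrightarrow> F i (X \<xi>') - y i) (at_right 0)"
    by (intro tendsto_diff data_tendsto i
        continuous_on_tendsto_compose[OF F_cont[OF i] X_tendsto[OF lim] B' evB])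
  have "((\<lambda>\<delta>. F' i (X (\<xi> \<delta>))) \<longlongrightarrow> F' i (X \<xi>')) (at_right 0)"
    by (rule continuous_on_tendsto_compose[OF F'_cont[OF i] X_tendsto[OF lim] B' evB])
  moreover have "eventually (\<lambda>\<delta>. \<forall>h. blinfun_apply (F' i (X (\<xi> \<delta>))) h \<in> Y i) (at_right 0)"
    using evB by (rule eventually_mono) (use F'_in_Y[OF i] in blast)
  moreover have "F i (X \<xi>') - y i \<in> Y i"
    using F_in_Y[OF i B'] y_in[OF i] by (rule subspace_diff[OF sub])
  ultimately show "((\<lambda>\<delta>. upd \<delta> (yd \<delta>) i (\<xi> \<delta>)) \<longlongrightarrow> upd 0 y i \<xi>') (at_right 0)"
    unfolding upd_def
    by (intro tendsto_diff lim lk_update_tendsto[OF sub Y_smooth[OF i] r_gt p_gt mu0_pos] res evY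
        F'_in_Y[OF i B'] tendsto_ident_at)
qed

lemma sweep_tendsto:
  assumes "((\<lambda>\<delta>. dual_iter \<delta> (yd \<delta>) n) \<longlongrightarrow> \<xi>n n) (at_right 0)" "i \<le> N"
  shows "((\<lambda>\<delta>. sweep \<delta> (yd \<delta>) (dual_iter \<delta> (yd \<delta>) n) i) \<longlongrightarrow> \<xi>ni n i) (at_right 0)"
  using assms(2)
proof (induction i)
  case (Suc i)
  then have i: "i < N" "i \<le> N" by auto
  have "((\<lambda>\<delta>. upd \<delta> (yd \<delta>) i (sweep \<delta> (yd \<delta>) (dual_iter \<delta> (yd \<delta>) n) i)) \<longlongrightarrow> upd 0 y i (\<xi>ni n i)) (at_right 0)"
    by (rule upd_tendsto(1)[OF i(1) Suc.IH[OF i(2)]])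
      (simp_all only: sweep_in_B noisy noisy_exact i)
  then show ?case by simp
qed (simp add: assms(1))

lemma dual_iter_tendsto: "((\<lambda>\<delta>. dual_iter \<delta> (yd \<delta>) n) \<longlongrightarrow> \<xi>n n) (at_right 0)"
proof (induction n)
  case (Suc n)
  then show ?case using sweep_tendsto[OF Suc order_refl] by simp
qed simp

text \<open>If the stopping index equals a fixed \<open>m\<close> for arbitrarily small \<open>\<delta>\<close>, then the exact iteration
  is stationary from \<open>m\<close> on, so its \<open>m\<close>-th iterate has already reached the limit.\<close>

lemma stopped_D_less:
  assumes xs: "sol xs" "(\<lambda>n. D (\<xi>n n) xs) \<longlonglongrightarrow> 0" and "\<epsilon> > 0"
  shows "eventually (\<lambda>\<delta>. (\<forall>i<N. resid \<delta> (yd \<delta>) m i = 0) \<longrightarrow> D (dual_iter \<delta> (yd \<delta>) m) xs < \<epsilon>) (at_right 0)"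
proof (cases "V m = 0")
  case True
  have "eventually (\<lambda>n. D (\<xi>n n) xs = D (\<xi>n m) xs) sequentially"
    unfolding eventually_sequentially
    by (intro exI[of _ m] allI impI arg_cong[where f = "\<lambda>\<xi>. D \<xi> xs"] stationary_later(1)[OF True])
  then have "(\<lambda>n. D (\<xi>n n) xs) \<longlonglongrightarrow> D (\<xi>n m) xs"
    by (rule tendsto_eventually)
  then have "D (\<xi>n m) xs = 0" using xs(2) LIMSEQ_unique by blast
  moreover have "((\<lambda>\<delta>. D (dual_iter \<delta> (yd \<delta>) m) xs) \<longlongrightarrow> D (\<xi>n m) xs) (at_right 0)"
    using xs(1) by (intro D_tendsto dual_iter_tendsto) (simp add: sol_def)
  ultimately have "eventually (\<lambda>\<delta>. D (dual_iter \<delta> (yd \<delta>) m) xs < \<epsilon>) (at_right 0)"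
    using \<open>\<epsilon> > 0\<close> by (intro order_tendstoD(2)) auto
  then show ?thesis by eventually_elim simp
next
  case False
  \<comment> \<open>An exact residual at \<open>m\<close> is nonzero, so its noisy counterpart
    eventually exceeds \<open>\<tau> * \<delta>\<close> and the implication becomes vacuous.\<close>
  then obtain i where i: "i < N" "en m i \<noteq> 0"
    unfolding V_def by (meson lessThan_iff sum.neutral)
  let ?v = "\<lambda>\<delta>. F i (X (sweep \<delta> (yd \<delta>) (dual_iter \<delta> (yd \<delta>) m) i)) - yd \<delta> i"
  have v: "(?v \<longlongrightarrow> F i (X (\<xi>ni m i)) - y i) (at_right 0)"
    by (rule upd_tendsto(2)[OF i(1) sweep_tendsto[OF dual_iter_tendsto less_imp_le[OF i(1)]]])
      (simp_all only: sweep_in_B noisy noisy_exact less_imp_le[OF i(1)])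
  have "((\<lambda>\<delta>. norm (?v \<delta>) - \<tau> * \<delta>) \<longlongrightarrow> norm (F i (X (\<xi>ni m i)) - y i) - \<tau> * 0) (at_right 0)"
    by (rule tendsto_diff[OF tendsto_norm[OF v] tendsto_mult[OF tendsto_const tendsto_ident_at]])
  moreover have "norm (F i (X (\<xi>ni m i)) - y i) - \<tau> * 0 > 0"
    using i(2) by (simp add: en_eq)
  ultimately have "eventually (\<lambda>\<delta>. norm (?v \<delta>) - \<tau> * \<delta> > 0) (at_right 0)"
    by (rule order_tendstoD(1))
  with eventually_at_right_less[of 0] show ?thesis
  proof eventually_elim
    case (elim \<delta>)
    then have "\<tau> * \<delta> \<ge> 0" using tau_gt by simp
    then have "resid \<delta> (yd \<delta>) m i \<noteq> 0"
      using elim by (auto simp: resid_def res_def active_norm_def)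
    then show ?case using i(1) by blast
  qed
qed

text \<open>Fix \<open>n\<close> with small exact distance. A stopping index at or beyond
  \<open>n\<close> is handled by monotonicity; an earlier one is among finitely many, each covered
  by \<open>stopped_D_less\<close>. The stopping index may thus stay bounded or grow as
  \<open>\<delta>\<close> tends to 0.\<close>

lemma stopped_D_tendsto:
  assumes xs: "sol xs" "(\<lambda>n. D (\<xi>n n) xs) \<longlonglongrightarrow> 0"
    and nd: "\<And>\<delta>. \<delta> > 0 \<Longrightarrow> \<forall>i<N. resid \<delta> (yd \<delta>) (nd \<delta>) i = 0"
  shows "((\<lambda>\<delta>. D (dual_iter \<delta> (yd \<delta>) (nd \<delta>)) xs) \<longlongrightarrow> 0) (at_right 0)"
proof (rule tendstoI)
  fix \<epsilon> :: real assume \<epsilon>: "\<epsilon> > 0"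
  have dom: "xs \<in> dom_fun \<Theta>" using xs(1) by (simp add: sol_def)
  obtain n where n: "D (\<xi>n n) xs < \<epsilon>"
    using eventually_happens'[OF _ order_tendstoD(2)[OF xs(2) \<epsilon>]] sequentially_bot by blast
  have "eventually (\<lambda>\<delta>. D (dual_iter \<delta> (yd \<delta>) n) xs < \<epsilon>) (at_right 0)"
    using n by (intro order_tendstoD(2)[OF D_tendsto[OF dual_iter_tendsto dom]])
  moreover have "eventually (\<lambda>\<delta>. \<forall>m\<in>{..<n}. (\<forall>i<N. resid \<delta> (yd \<delta>) m i = 0) \<longrightarrow>
      D (dual_iter \<delta> (yd \<delta>) m) xs < \<epsilon>) (at_right 0)"
    by (intro eventually_ball_finite ballI stopped_D_less xs \<epsilon>) simp
  ultimately show "eventually (\<lambda>\<delta>. dist (D (dual_iter \<delta> (yd \<delta>) (nd \<delta>)) xs) 0 < \<epsilon>) (at_right 0)"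
    using eventually_at_right_less[of 0]
  proof eventually_elim
    case (elim \<delta>)
    have "D (dual_iter \<delta> (yd \<delta>) (nd \<delta>)) xs < \<epsilon>"
    proof (cases "n \<le> nd \<delta>")
      case True
      then show ?thesis using dual_iter_mono[OF noisy[OF elim(3)] xs(1) True] elim(1) by linarith
    next
      case False
      then show ?thesis using elim(2) nd[OF elim(3)] by simp
    qed
    then show ?case using D_nonneg[OF dom] by (simp add: dist_real_def)
  qed
qed

end

end

section \<open>Transfer to the algorithm as stated\<close>

theorem theorem3p9:
  fixes N :: nat
    and Y :: "nat \<Rightarrow> 'b::banach set"
    and DF :: "nat \<Rightarrow> 'a::banach set"
    and F :: "nat \<Rightarrow> 'a \<Rightarrow> 'b"
    and F' :: "nat \<Rightarrow> 'a \<Rightarrow> ('a \<Rightarrow>\<^sub>L 'b)"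
    and y :: "nat \<Rightarrow> 'b"
    and \<Theta> :: "'a \<Rightarrow> ereal"
    and \<xi>0 :: "'a \<Rightarrow>\<^sub>L real" and x0 xdag :: 'a
    and p r \<rho> \<eta> c0 \<tau> \<mu>0 :: real
    and yd :: "real \<Rightarrow> nat \<Rightarrow> 'b"
    and \<xi>d :: "real \<Rightarrow> nat \<Rightarrow> ('a \<Rightarrow>\<^sub>L real)" and xd :: "real \<Rightarrow> nat \<Rightarrow> 'a"
    and nd :: "real \<Rightarrow> nat"
  assumes X_reflexive: "reflexive_space TYPE('a)"
    and N_pos: "N \<ge> 1"
    and Y_banach: "\<And>i. i < N \<Longrightarrow> subspace (Y i) \<and> closed (Y i)"
    and Y_smooth: "\<And>i. i < N \<Longrightarrow> uniformly_smooth_on (Y i)"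
    and F_maps: "\<And>i x. i < N \<Longrightarrow> x \<in> DF i \<Longrightarrow> F i x \<in> Y i"
    and y_in: "\<And>i. i < N \<Longrightarrow> y i \<in> Y i"
    and dom_ne: "(\<Inter>i<N. DF i) \<noteq> {}"
    and p_ge: "p \<ge> 2"
    and Theta_proper: "proper_fun \<Theta>"
    and Theta_lsc: "lower_semicontinuous \<Theta>"
    and Theta_pconvex: "p_convex p \<Theta>"
    and c0_pos: "c0 > 0"
    and Theta_bregman: "\<And>x' x \<xi>. x \<in> dom_subdifferential \<Theta> \<Longrightarrow> \<xi> \<in> subdifferential \<Theta> x \<Longrightarrow>
           bregman \<Theta> \<xi> x' x \<ge> ereal (c0 * norm (x' - x) powr p)"
    and x0_def: "x0 = argmin_tilted \<Theta> \<xi>0"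
    and A: "assumption_A N Y DF F F' y \<Theta> x0 \<rho> \<eta>"
    and xdag: "is_arg_min (\<lambda>x. bregman \<Theta> \<xi>0 x x0)
                 (\<lambda>x. x \<in> dom_fun \<Theta> \<inter> (\<Inter>i<N. DF i) \<and> solves N F y x) xdag"
    and xdag_close: "bregman \<Theta> \<xi>0 xdag x0 \<le> ereal (c0 * \<rho> powr p)"
    and r_gt: "r > 1"
    and tau_gt: "\<tau> > 1"
    and mu0_pos: "\<mu>0 > 0"
    and params: "1 - \<eta> - (1 + \<eta>) / \<tau> - (p - 1) / p * (\<mu>0 / (2 * c0)) powr (1 / (p - 1)) > 0"
    and data: "\<And>\<delta> i. \<delta> > 0 \<Longrightarrow> i < N \<Longrightarrow> yd \<delta> i \<in> Y i \<and> norm (yd \<delta> i - y i) \<le> \<delta>"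
    and iterates: "\<And>\<delta> n. \<delta> > 0 \<Longrightarrow>
           (\<xi>d \<delta> n, xd \<delta> n) = lk_iter N Y F F' \<Theta> p r \<tau> \<mu>0 \<delta> (yd \<delta>) (\<xi>0, x0) n"
    and stopping: "\<And>\<delta>. \<delta> > 0 \<Longrightarrow>
           nd \<delta> = lk_stop N Y F F' \<Theta> p r \<tau> \<mu>0 \<delta> (yd \<delta>) (\<xi>0, x0)"
  shows "\<exists>xs \<in> cball x0 (2 * \<rho>) \<inter> dom_fun \<Theta>. solves N F y xs
           \<and> ((\<lambda>\<delta>. norm (xd \<delta> (nd \<delta>) - xs)) \<longlongrightarrow> 0) (at_right 0)
           \<and> ((\<lambda>\<delta>. bregman \<Theta> (\<xi>d \<delta> (nd \<delta>)) xs (xd \<delta> (nd \<delta>))) \<longlongrightarrow> 0) (at_right 0)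
           \<and> ((\<forall>i<N. \<forall>x \<in> cball x0 (2 * \<rho>) \<inter> (\<Inter>j<N. DF j).
                  null_space (F' i xdag) \<subseteq> null_space (F' i x)) \<longrightarrow> xs = xdag)"
proof -
  interpret lk_system \<Theta> p c0 N Y DF F F' y \<xi>0 x0 xdag r \<rho> \<eta> \<tau> \<mu>0
    by unfold_locales (fact p_ge Theta_proper Theta_lsc Theta_pconvex c0_pos Theta_bregman Y_banach
        Y_smooth F_maps y_in x0_def A xdag xdag_close r_gt tau_gt mu0_pos params)+
  obtain xs where xs: "sol xs" "(\<lambda>n. D (\<xi>n n) xs) \<longlonglongrightarrow> 0"
    by (rule exact_limit_exists)
  have xs_dom: "xs \<in> dom_fun \<Theta>" using xs(1) by (simp add: sol_def)
  have noisy: "noisy \<delta> (yd \<delta>)" if "\<delta> > 0" for \<delta>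
    using data that by (simp add: noisy_def)
  define \<xi>s where "\<xi>s \<delta> = dual_iter \<delta> (yd \<delta>) (nd \<delta>)" for \<delta>
  have it: "\<xi>d \<delta> (nd \<delta>) = \<xi>s \<delta>" "xd \<delta> (nd \<delta>) = X (\<xi>s \<delta>)" if "\<delta> > 0" for \<delta>
    using iterates[OF that, of "nd \<delta>"] dual_iter_invariant[OF noisy[OF that], of "nd \<delta>"]
    by (simp_all add: \<xi>s_def)
  have "\<forall>i<N. resid \<delta> (yd \<delta>) (nd \<delta>) i = 0" if "\<delta> > 0" for \<delta>
    unfolding stopping[OF that] lk_stop_eq[OF noisy[OF that]]
    using discrepancy_met[OF noisy[OF that] that] by (rule LeastI_ex)
  then have lim: "((\<lambda>\<delta>. D (\<xi>s \<delta>) xs) \<longlongrightarrow> 0) (at_right 0)"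
    unfolding \<xi>s_def by (intro stopped_D_tendsto noisy xs)
  \<comment> \<open>Data and iterates are constrained for \<open>\<delta> > 0\<close> only, so
    identities involving them are stated eventually to the right of 0.\<close>
  note pos = eventually_at_right_less[of "0::real"]
  have "((\<lambda>\<delta>. norm (X (\<xi>s \<delta>) - xs)) \<longlongrightarrow> 0) (at_right 0)"
    using D_tendsto_0_X_tendsto[OF lim xs_dom] by (simp add: tendsto_norm_zero_iff LIM_zero_iff)
  moreover have "eventually (\<lambda>\<delta>. norm (X (\<xi>s \<delta>) - xs) = norm (xd \<delta> (nd \<delta>) - xs)) (at_right 0)"
    using pos by (rule eventually_mono) (simp add: it)
  ultimately have conv: "((\<lambda>\<delta>. norm (xd \<delta> (nd \<delta>) - xs)) \<longlongrightarrow> 0) (at_right 0)"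
    by (rule Lim_transform_eventually)
  have "((\<lambda>\<delta>. ereal (D (\<xi>s \<delta>) xs)) \<longlongrightarrow> 0) (at_right 0)"
    using lim by (simp add: zero_ereal_def)
  moreover have "eventually (\<lambda>\<delta>. ereal (D (\<xi>s \<delta>) xs)
      = bregman \<Theta> (\<xi>d \<delta> (nd \<delta>)) xs (xd \<delta> (nd \<delta>))) (at_right 0)"
    using pos by (rule eventually_mono) (simp add: it bregman_X[OF xs_dom])
  ultimately have breg: "((\<lambda>\<delta>. bregman \<Theta> (\<xi>d \<delta> (nd \<delta>)) xs (xd \<delta> (nd \<delta>))) \<longlongrightarrow> 0) (at_right 0)"
    by (rule Lim_transform_eventually)
  have "xs = xdag" if "\<forall>i<N. \<forall>x \<in> cball x0 (2 * \<rho>) \<inter> (\<Inter>j<N. DF j).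
      null_space (F' i xdag) \<subseteq> null_space (F' i x)"
    using that ball_dom by (intro exact_limit_eq_xdag[OF xs]) auto
  then show ?thesis
    using xs(1) conv breg by (intro bexI[of _ xs]) (auto simp: sol_def)
qed

end
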